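(* Let $d>0$, let $\mu$ be a $d$-Ahlfors regular probability measure on a metric space, and let $(x_j)_{j\in\mathbb{N}}$ be i.i.d. samples from $\mu$. If $0<\alpha<d$, then $E^0_\alpha(x_1,\ldots,x_n)\approx n^{\frac{d-\alpha}{d}}$ with high probability as $n\to\infty$; that is, there are constants $0<C_1\le C_2$, independent of $n$, such that $$\lim_{n\to\infty}\mathbb{P}\left(C_1\, n^{\frac{d-\alpha}{d}}\le E^0_\alpha(x_1,\ldots,x_n)\le C_2\, n^{\frac{d-\alpha}{d}}\right)=1 .$$
   Context: A probability measure $\mu$ with support $X$ (a metric space) is $d$-Ahlfors regular if there exist real numbers $c,\delta_0>0$ such that $\frac1c\delta^d\le\mu(B_\delta(x))\le c\,\delta^d$ for all $x\in X$ and $0<\delta<\delta_0$, where $B_\delta(x)$ is the open ball of radius $\delta$ centered at $x$. For a finite metric space $\{x_1,\ldots,x_n\}$, $T(x_1,\ldots,x_n)$ denotes a minimum spanning tree of the complete graph on $x_1,\ldots,x_n$ with edge lengths given by the distances, $|e|$ denotes the length of an edge $e$, and $E_\alpha^0(x_1,\ldots,x_n)=\sum_{e\in T(x_1,\ldots,x_n)}|e|^\alpha$. *)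

theory Defs
  imports "HOL-Probability.Probability"
begin

definition measure_support :: "'a::metric_space measure \<Rightarrow> 'a set" where
  "measure_support \<mu> = {x. \<forall>r>0. emeasure \<mu> (ball x r) > 0}"

text \<open>
  A measure with support \<open>X\<close> is understood to be carried by \<open>X\<close>. This is automatic when the ambient
  space is separable; in general it has to be required, since otherwise the support may even be
  empty and the ball condition vacuous.
\<close>

definition ahlfors_regular :: "real \<Rightarrow> 'a::metric_space measure \<Rightarrow> bool" where
  "ahlfors_regular d \<mu> \<longleftrightarrow>
     prob_space \<mu> \<and> sets \<mu> = sets borel \<and> emeasure \<mu> (measure_support \<mu>) = 1 \<and>
     (\<exists>c \<delta>0. c > 0 \<and> \<delta>0 > 0 \<and>
        (\<forall>x\<in>measure_support \<mu>. \<forall>\<delta>. 0 < \<delta> \<and> \<delta> < \<delta>0 \<longrightarrow>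
           1 / c * \<delta> powr d \<le> measure \<mu> (ball x \<delta>) \<and> measure \<mu> (ball x \<delta>) \<le> c * \<delta> powr d))"

text \<open>
  Undirected simple graphs on a vertex set \<open>V\<close> are given by their edge sets, an edge being a
  two-element subset of \<open>V\<close>. The predicate \<open>spanning_tree\<close> of the session Graph_Theory is not
  used: there a forest only has to be free of directed cycles, so a transitively oriented triangle
  would count as a tree.
\<close>

definition complete_graph_edges :: "'v set \<Rightarrow> 'v set set" where
  "complete_graph_edges V = {{u, v} |u v. u \<in> V \<and> v \<in> V \<and> u \<noteq> v}"

definition connected_graph :: "'v set \<Rightarrow> 'v set set \<Rightarrow> bool" where
  "connected_graph V F \<longleftrightarrow> (\<forall>u\<in>V. \<forall>v\<in>V. (u, v) \<in> {(a, b). {a, b} \<in> F}\<^sup>*)"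

definition graph_cycle :: "'v set set \<Rightarrow> 'v list \<Rightarrow> bool" where
  "graph_cycle F p \<longleftrightarrow> length p \<ge> 3 \<and> distinct p \<and>
     (\<forall>i<length p. {p ! i, p ! (Suc i mod length p)} \<in> F)"

definition is_spanning_tree :: "'v set \<Rightarrow> 'v set set \<Rightarrow> bool" where
  "is_spanning_tree V F \<longleftrightarrow>
     F \<subseteq> complete_graph_edges V \<and> connected_graph V F \<and> (\<nexists>p. graph_cycle F p)"

text \<open>
  The vertices of the complete graph on \<open>x\<^sub>1, \<dots>, x\<^sub>n\<close> are the indices \<open>1, \<dots>, n\<close>. If some
  points coincide, this only adds edges of length \<open>0\<close>, which do not contribute to the power sums
  below for positive exponents.
\<close>

definition edge_length :: "('v \<Rightarrow> 'a::metric_space) \<Rightarrow> 'v set \<Rightarrow> real" where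
  "edge_length x e = diameter (x ` e)"

lemma edge_length_pair: "edge_length x {u, v} = dist (x u) (x v)"
proof (rule antisym)
  show "edge_length x {u, v} \<le> dist (x u) (x v)"
    unfolding edge_length_def diameter_def by (auto simp: dist_commute cSup_eq_Max)
  show "dist (x u) (x v) \<le> edge_length x {u, v}"
    unfolding edge_length_def
    by (rule diameter_bounded_bound) (auto intro: finite_imp_bounded)
qed

definition is_min_spanning_tree :: "('v \<Rightarrow> 'a::metric_space) \<Rightarrow> 'v set \<Rightarrow> 'v set set \<Rightarrow> bool" where
  "is_min_spanning_tree x V F \<longleftrightarrow> is_spanning_tree V F \<and>
     (\<forall>F'. is_spanning_tree V F' \<longrightarrow> (\<Sum>e\<in>F. edge_length x e) \<le> (\<Sum>e\<in>F'. edge_length x e))"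

text \<open>
  A minimum spanning tree need not be unique, but all of them have the same multiset of edge
  lengths, so the choice made here does not affect the sum \<open>E0\<close>.
\<close>

definition min_spanning_tree :: "(nat \<Rightarrow> 'a::metric_space) \<Rightarrow> nat \<Rightarrow> nat set set" where
  "min_spanning_tree x n = (SOME F. is_min_spanning_tree x {1..n} F)"

definition E0 :: "real \<Rightarrow> (nat \<Rightarrow> 'a::metric_space) \<Rightarrow> nat \<Rightarrow> real" where
  "E0 \<alpha> x n = (\<Sum>e\<in>min_spanning_tree x n. edge_length x e powr \<alpha>)"

text \<open>
  If the ambient space is not separable, distances between Borel random points need not be
  measurable, and events defined by \<open>E0\<close> are only measurable up to a null set. Their probability is
  therefore to be taken in the completion of the underlying probability space; by the library lemma
  \<open>measure_completion\<close>, measurable events keep their probability.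
\<close>

end

theory Submission
  imports Defs
begin

text \<open>
  Write \<open>X\<close> for the support of the measure and \<open>s = (d - \<alpha>) / d = 1 - \<alpha> / d\<close>. Both bounds come from counting
  long edges.

  The upper bound holds for every configuration of \<open>n\<close> points of \<open>X\<close>. If a minimum spanning tree has \<open>k\<close>
  edges of length at least \<open>\<epsilon>\<close>, then removing them leaves \<open>k + 1\<close> components, and vertices of different
  components are at distance at least \<open>\<epsilon>\<close>, because otherwise a long edge could be exchanged for a shorter
  one (\<open>long_edges_give_separated_vertices\<close>). Disjoint balls around such vertices have total mass at most \<open>1\<close>,
  so \<open>k\<close> is at most a multiple of \<open>\<epsilon>\<^sup>-\<^sup>d\<close> (\<open>ahlfors_packing\<close>). Hence the \<open>k\<close>-th longest edge has length at most a
  multiple of \<open>k\<^sup>-\<^sup>1\<^sup>/\<^sup>d\<close>, and the sum of the \<open>\<alpha>\<close>-th powers is at most a multiple of \<open>n\<^sup>s\<close>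
  (\<open>sum_powr_le_of_count_bound\<close>).

  The lower bound holds for every spanning tree, as soon as half of the points are isolated at a scale
  proportional to \<open>\<epsilon> = \<theta> n\<^sup>-\<^sup>1\<^sup>/\<^sup>d\<close>: each isolated point needs a long edge. Reveal the points one after the
  other. The probability that a point falls within \<open>\<epsilon>\<close> of an earlier one is at most \<open>n c \<epsilon>\<^sup>d\<close>, whatever
  the earlier points are, and this is as small as desired for small \<open>\<theta>\<close>. By a union bound over sets of
  indices, at most \<open>n / 4\<close> points do so, except with probability \<open>2\<^sup>-\<^sup>n\<close> (\<open>prob_few_near_earlier\<close>), and
  then at most \<open>n / 2\<close> points fail to be isolated at scale \<open>\<epsilon> / 2\<close> (\<open>nonisolated_le_twice_near_earlier\<close>).

  As the ambient space is arbitrary, measurability has to be argued: \<open>X\<close> is totally bounded by the packing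
  bound, hence separable, and the sample lies in \<open>X\<close> almost surely, so the power sum agrees almost surely with
  a measurable function of the distances (\<open>E0_event\<close>).
\<close>

section \<open>Walks, bridges and spanning trees\<close>

definition joined :: "'v set set \<Rightarrow> 'v \<Rightarrow> 'v \<Rightarrow> bool" where
  "joined F u v \<longleftrightarrow> (u, v) \<in> {(a, b). {a, b} \<in> F}\<^sup>*"

lemma connected_graph_iff_joined: "connected_graph V F \<longleftrightarrow> (\<forall>u\<in>V. \<forall>v\<in>V. joined F u v)"
  unfolding connected_graph_def joined_def ..

lemma joined_refl [simp]: "joined F u u"
  unfolding joined_def by simp

lemma joined_edge: "{u, v} \<in> F \<Longrightarrow> joined F u v"
  unfolding joined_def by blast

lemma joined_induct [consumes 1, case_names refl step]:
  assumes "joined F u v" "Q u"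
    and "\<And>w z. joined F u w \<Longrightarrow> {w, z} \<in> F \<Longrightarrow> Q w \<Longrightarrow> Q z"
  shows "Q v"
  using assms(1) unfolding joined_def
  by (induction rule: rtrancl_induct) (use assms(2,3) in \<open>auto simp: joined_def\<close>)

lemma joined_sym: "joined F u v \<Longrightarrow> joined F v u"
proof -
  have "sym ({(a, b). {a, b} \<in> F}\<^sup>*)"
    by (intro sym_rtrancl symI) (auto simp: insert_commute)
  then show "joined F u v \<Longrightarrow> joined F v u" unfolding joined_def by (rule symD)
qed

lemma joined_trans: "joined F u v \<Longrightarrow> joined F v w \<Longrightarrow> joined F u w"
  unfolding joined_def by (rule rtrancl_trans)

lemma joined_mono: "joined F u v \<Longrightarrow> F \<subseteq> G \<Longrightarrow> joined G u v"
  unfolding joined_def by (erule rtrancl_mono[THEN subsetD, rotated]) auto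

text \<open>
  A walk that is cut by the deletion of an edge first reaches one end of that edge and, after its last
  passage through the edge, continues from an end to its target. Only this much about walks is needed
  to exchange edges.
\<close>

lemma joined_delete_edge:
  assumes "joined F u v"
  shows "joined (F - {{a, b}}) u v \<or>
    joined (F - {{a, b}}) u a \<and> joined (F - {{a, b}}) b v \<or>
    joined (F - {{a, b}}) u b \<and> joined (F - {{a, b}}) a v"
  using assms
proof (induction rule: joined_induct)
  case (step w z)
  show ?case
  proof (cases "{w, z} = {a, b}")
    case True
    then have "w = a \<and> z = b \<or> w = b \<and> z = a" by (auto simp: doubleton_eq_iff)
    with step.IH show ?thesis by auto
  next
    case False
    with step.hyps have "joined (F - {{a, b}}) w z" by (intro joined_edge) simp
    with step.IH show ?thesis by (meson joined_trans)
  qed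
qed simp

lemma joined_imp_simple_path:
  assumes "joined F u v"
  obtains p where "p \<noteq> []" "hd p = u" "last p = v" "distinct p"
    "successively (\<lambda>a b. {a, b} \<in> F) p"
proof -
  from assms have "\<exists>p. p \<noteq> [] \<and> hd p = u \<and> last p = v \<and> distinct p \<and>
    successively (\<lambda>a b. {a, b} \<in> F) p"
  proof (induction rule: joined_induct)
    case refl
    then show ?case by (intro exI[of _ "[u]"]) simp
  next
    case (step w z)
    then obtain p where p: "p \<noteq> []" "hd p = u" "last p = w" "distinct p"
      "successively (\<lambda>a b. {a, b} \<in> F) p" by blast
    show ?case
    proof (cases "z \<in> set p")
      case True
      then obtain q r where "p = q @ z # r" by (meson split_list)
      with p show ?thesis
        by (intro exI[of _ "q @ [z]"]) (auto simp: successively_append_iff hd_append split: if_splits)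
    next
      case False
      with p step.hyps show ?thesis
        by (intro exI[of _ "p @ [z]"]) (auto simp: successively_append_iff)
    qed
  qed
  then show thesis using that by blast
qed

text \<open>
  A simple path between the ends of an edge that avoids the edge has at least three vertices and
  would be closed to a cycle by it.
\<close>

lemma acyclic_edge_is_bridge:
  assumes "\<nexists>p. graph_cycle F p" "{u, v} \<in> F" "u \<noteq> v"
  shows "\<not> joined (F - {{u, v}}) u v"
proof
  assume "joined (F - {{u, v}}) u v"
  then obtain p where p: "p \<noteq> []" "hd p = u" "last p = v" "distinct p"
    "successively (\<lambda>a b. {a, b} \<in> F - {{u, v}}) p" by (rule joined_imp_simple_path)
  have nth: "{p ! i, p ! Suc i} \<in> F - {{u, v}}" if "Suc i < length p" for i
    using p(5) that unfolding successively_conv_nth by blast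
  have u: "p ! 0 = u" and v: "p ! (length p - 1) = v"
    using p(1-3) by (auto simp: hd_conv_nth last_conv_nth)
  have len: "length p \<ge> 3"
  proof (rule ccontr)
    assume "\<not> length p \<ge> 3"
    moreover have "length p \<noteq> 0" using p(1) by simp
    ultimately have "length p = 1 \<or> length p = 2" by linarith
    then show False using u v nth[of 0] \<open>u \<noteq> v\<close> by auto
  qed
  have "{p ! i, p ! (Suc i mod length p)} \<in> F" if "i < length p" for i
  proof (cases "Suc i < length p")
    case True then show ?thesis using nth[of i] by auto
  next
    case False
    then have "Suc i = length p" "i = length p - 1" using that by auto
    then show ?thesis using u v assms(2) by (auto simp: insert_commute)
  qed
  then have "graph_cycle F p" using len p(4) unfolding graph_cycle_def by blast
  with assms(1) show False by blast
qed

text \<open>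
  The closing edge of the vertex list of a cycle can be dropped: the other edges of the list still
  lead from its first vertex to its last.
\<close>

lemma connected_graph_delete_cycle_edge:
  assumes conn: "connected_graph V F" and cyc: "graph_cycle F p"
  obtains e where "e \<in> F" "connected_graph V (F - {e})"
proof -
  let ?n = "length p"
  define e where "e = {p ! (?n - 1), p ! 0}"
  have n: "?n \<ge> 3" and dist: "distinct p"
    and edge: "\<And>i. i < ?n \<Longrightarrow> {p ! i, p ! (Suc i mod ?n)} \<in> F"
    using cyc unfolding graph_cycle_def by auto
  have eF: "e \<in> F"
  proof -
    have "Suc (?n - 1) = ?n" using n by simp
    then show ?thesis using edge[of "?n - 1"] n unfolding e_def by simp
  qed
  have walk: "i < ?n \<Longrightarrow> joined (F - {e}) (p ! 0) (p ! i)" for i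
  proof (induction i)
    case (Suc i)
    have "{p ! i, p ! Suc i} \<in> F" using edge[of i] Suc.prems by simp
    moreover have "{p ! i, p ! Suc i} \<noteq> e"
    proof
      assume "{p ! i, p ! Suc i} = e"
      then have "p ! i = p ! (?n - 1) \<and> p ! Suc i = p ! 0 \<or> p ! i = p ! 0 \<and> p ! Suc i = p ! (?n - 1)"
        unfolding e_def by (auto simp: doubleton_eq_iff)
      then have "i = ?n - 1 \<and> Suc i = 0 \<or> i = 0 \<and> Suc i = ?n - 1"
        using nth_eq_iff_index_eq[OF dist, of i "?n - 1"] nth_eq_iff_index_eq[OF dist, of "Suc i" 0]
          nth_eq_iff_index_eq[OF dist, of i 0] nth_eq_iff_index_eq[OF dist, of "Suc i" "?n - 1"]
          Suc.prems n by linarith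
      then show False using n by auto
    qed
    ultimately have "joined (F - {e}) (p ! i) (p ! Suc i)" by (intro joined_edge) simp
    with Suc show ?case by (meson Suc_lessD joined_trans)
  qed simp
  have closing: "joined (F - {e}) (p ! 0) (p ! (?n - 1))" by (rule walk) (use n in simp)
  have "joined (F - {e}) u v" if "u \<in> V" "v \<in> V" for u v
  proof -
    have "joined F u v" using conn that unfolding connected_graph_iff_joined by blast
    from joined_delete_edge[OF this, of "p ! (?n - 1)" "p ! 0"]
    show ?thesis using closing unfolding e_def[symmetric] by (meson joined_sym joined_trans)
  qed
  then have "connected_graph V (F - {e})" unfolding connected_graph_iff_joined by blast
  with eF show thesis by (rule that)
qed

text \<open>
  Keep deleting cycle edges. In exchange arguments this saves any check that the graph obtained by
  trading one edge for another has no cycles: it is enough that it is connected, since a spanning tree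
  inside it weighs no more.
\<close>

lemma connected_graph_contains_spanning_tree:
  assumes "finite F" "F \<subseteq> complete_graph_edges V" "connected_graph V F"
  obtains T where "T \<subseteq> F" "is_spanning_tree V T"
proof -
  have "\<exists>T\<subseteq>F. is_spanning_tree V T"
    using assms
  proof (induction F rule: finite_psubset_induct)
    case (psubset F)
    show ?case
    proof (cases "\<exists>p. graph_cycle F p")
      case True
      then obtain e where e: "e \<in> F" "connected_graph V (F - {e})"
        using connected_graph_delete_cycle_edge[OF psubset.prems(2)] by blast
      have "\<exists>T\<subseteq>F - {e}. is_spanning_tree V T"
        by (rule psubset.IH) (use e psubset.prems in auto)
      then show ?thesis by blast
    next
      case False
      with psubset.prems show ?thesis unfolding is_spanning_tree_def by blast
    qed
  qed
  then show thesis using that by blast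
qed

section \<open>Minimum spanning trees\<close>

lemma finite_complete_graph_edges: "finite V \<Longrightarrow> finite (complete_graph_edges V)"
  by (rule finite_subset[of _ "Pow V"]) (auto simp: complete_graph_edges_def)

lemma is_spanning_tree_finite: "finite V \<Longrightarrow> is_spanning_tree V F \<Longrightarrow> finite F"
  unfolding is_spanning_tree_def by (meson finite_complete_graph_edges finite_subset)

lemma finite_spanning_trees: "finite V \<Longrightarrow> finite {F. is_spanning_tree V F}"
  by (rule finite_subset[of _ "Pow (complete_graph_edges V)"])
    (auto simp: is_spanning_tree_def finite_complete_graph_edges)

lemma edge_length_nonneg: "e \<in> complete_graph_edges V \<Longrightarrow> edge_length x e \<ge> 0"
  by (auto simp: complete_graph_edges_def edge_length_pair)

lemma min_spanning_tree_exists: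
  assumes "finite V"
  shows "\<exists>F. is_min_spanning_tree x V F"
proof -
  have "connected_graph V (complete_graph_edges V)"
    unfolding connected_graph_iff_joined
  proof (intro ballI)
    fix u v assume "u \<in> V" "v \<in> V"
    then show "joined (complete_graph_edges V) u v"
      by (cases "u = v") (auto intro!: joined_edge simp: complete_graph_edges_def)
  qed
  then have "{F. is_spanning_tree V F} \<noteq> {}"
    using connected_graph_contains_spanning_tree[of "complete_graph_edges V" V]
      finite_complete_graph_edges[OF assms] by blast
  from ex_min_if_finite[OF finite_imageI[OF finite_spanning_trees[OF assms]], of "\<lambda>F. \<Sum>e\<in>F. edge_length x e"] this
  show ?thesis unfolding is_min_spanning_tree_def by (force simp: not_less)
qed

lemma min_spanning_tree_is_min: "is_min_spanning_tree x {1..n} (min_spanning_tree x n)"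
  unfolding min_spanning_tree_def by (rule someI_ex) (simp add: min_spanning_tree_exists)

text \<open>
  Each edge removed from a forest splits a component, so removing \<open>k\<close> edges leaves more than \<open>k\<close>
  components. The lemma produces representatives of \<open>k + 1\<close> of them. For the removal of one further edge
  \<open>{a, b}\<close>, the old representatives cannot meet both the new component of \<open>a\<close> and that of \<open>b\<close>: these
  two were one component before. The free one gets \<open>a\<close> or \<open>b\<close> as its representative.
\<close>

lemma forest_components_after_deletion:
  assumes "finite V" "V \<noteq> {}" "F \<subseteq> complete_graph_edges V" "\<nexists>p. graph_cycle F p"
    and "finite D" "D \<subseteq> F"
  shows "\<exists>R\<subseteq>V. card R = Suc (card D) \<and> (\<forall>u\<in>R. \<forall>v\<in>R. joined (F - D) u v \<longrightarrow> u = v)"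
  using assms(5,6)
proof (induction D rule: finite_induct)
  case empty
  obtain u where "u \<in> V" using assms(2) by blast
  then show ?case by (intro exI[of _ "{u}"]) auto
next
  case (insert e D)
  then obtain R where R: "R \<subseteq> V" "card R = Suc (card D)"
    and sep: "\<And>u v. u \<in> R \<Longrightarrow> v \<in> R \<Longrightarrow> joined (F - D) u v \<Longrightarrow> u = v" by auto
  have finR: "finite R" using R(1) assms(1) finite_subset by blast
  obtain a b where ab: "e = {a, b}" "a \<in> V" "b \<in> V" "a \<noteq> b"
    using insert.prems assms(3) unfolding complete_graph_edges_def by blast
  have sub: "F - insert e D \<subseteq> F - D" "F - insert e D \<subseteq> F - {{a, b}}" using ab by auto
  have "\<not> joined (F - {{a, b}}) a b"
    by (rule acyclic_edge_is_bridge[OF assms(4)]) (use insert.prems ab in auto)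
  then have bridge: "\<not> joined (F - insert e D) a b" using joined_mono sub(2) by metis
  have ab_join: "joined (F - D) a b" by (rule joined_edge) (use insert ab in auto)
  have "\<exists>c\<in>V. \<forall>r\<in>R. \<not> joined (F - insert e D) r c"
  proof (rule ccontr)
    assume "\<not> ?thesis"
    then obtain r s where rs: "r \<in> R" "s \<in> R" "joined (F - insert e D) r a"
      "joined (F - insert e D) s b" using ab by blast
    have "joined (F - D) r a" "joined (F - D) s b" using rs(3,4) joined_mono[OF _ sub(1)] by auto
    then have "joined (F - D) r s" using ab_join by (meson joined_sym joined_trans)
    then have "r = s" using sep rs by blast
    then have "joined (F - insert e D) a b" using rs by (meson joined_sym joined_trans)
    with bridge show False ..
  qed
  then obtain c where c: "c \<in> V" "\<And>r. r \<in> R \<Longrightarrow> \<not> joined (F - insert e D) r c" by blast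
  have "c \<notin> R" using c(2)[of c] by auto
  have "u = v" if "u \<in> insert c R" "v \<in> insert c R" "joined (F - insert e D) u v" for u v
    using that(1,2) c(2)[of u] c(2)[of v] that(3) joined_sym[OF that(3)]
      sep[OF _ _ joined_mono[OF that(3) sub(1)]] by auto
  then show ?case
    using R c(1) \<open>c \<notin> R\<close> finR insert.hyps by (intro exI[of _ "insert c R"]) auto
qed

text \<open>
  Removing all edges of the tree leaves one representative per edge and one more, all distinct.
\<close>

lemma card_spanning_tree_le:
  assumes "finite V" "V \<noteq> {}" "is_spanning_tree V F"
  shows "Suc (card F) \<le> card V"
  using forest_components_after_deletion[of V F F] assms is_spanning_tree_finite[OF assms(1,3)]
  unfolding is_spanning_tree_def by (metis card_mono order_refl)

text \<open>
  If removing all of \<open>D\<close> separates \<open>u\<close> from \<open>v\<close>, then so does some single edge of \<open>D\<close> once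
  suitable other ones are gone. That edge lies on a path from \<open>u\<close> to \<open>v\<close>.
\<close>

lemma crossing_edge:
  assumes "finite D" "joined F u v" "\<not> joined (F - D) u v"
  obtains e H where "e \<in> D" "joined (F - H) u v" "\<not> joined (F - H - {e}) u v"
proof -
  have "\<exists>e\<in>D. \<exists>H. joined (F - H) u v \<and> \<not> joined (F - H - {e}) u v"
    using assms(1,3)
  proof (induction D rule: finite_induct)
    case empty
    then show ?case using assms(2) by simp
  next
    case (insert e D)
    have "F - insert e D = F - D - {e}" by auto
    then show ?case using insert by (cases "joined (F - D) u v") (auto 0 4)
  qed
  then show thesis using that by blast
qed

text \<open>
  The exchange argument. If the distance of \<open>u\<close> and \<open>v\<close> were below \<open>\<epsilon>\<close>, then the edge \<open>{u, v}\<close> could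
  replace an edge of length at least \<open>\<epsilon>\<close> on the tree path from \<open>u\<close> to \<open>v\<close>, which would
  make the tree shorter.
\<close>

lemma min_spanning_tree_cut:
  assumes V: "finite V" and mst: "is_min_spanning_tree x V F"
    and uv: "u \<in> V" "v \<in> V" "u \<noteq> v"
    and not_joined: "\<not> joined (F - {e\<in>F. \<epsilon> \<le> edge_length x e}) u v"
  shows "\<epsilon> \<le> dist (x u) (x v)"
proof (rule ccontr)
  assume short: "\<not> \<epsilon> \<le> dist (x u) (x v)"
  let ?w = "\<lambda>G. \<Sum>e\<in>G. edge_length x e"
  have tree: "is_spanning_tree V F" and min: "\<And>T. is_spanning_tree V T \<Longrightarrow> ?w F \<le> ?w T"
    using mst unfolding is_min_spanning_tree_def by auto
  have finF: "finite F" using is_spanning_tree_finite[OF V tree] .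
  have FK: "F \<subseteq> complete_graph_edges V" and conn: "connected_graph V F"
    using tree unfolding is_spanning_tree_def by auto
  have "finite {e\<in>F. \<epsilon> \<le> edge_length x e}" using finF by simp
  moreover have "joined F u v" using conn uv unfolding connected_graph_iff_joined by blast
  ultimately obtain e H where "e \<in> {e\<in>F. \<epsilon> \<le> edge_length x e}"
    and eH: "joined (F - H) u v" "\<not> joined (F - H - {e}) u v"
    by (rule crossing_edge[OF _ _ not_joined])
  then have e: "e \<in> F" "\<epsilon> \<le> edge_length x e" by auto
  obtain a b where ab: "e = {a, b}" using e(1) FK unfolding complete_graph_edges_def by blast
  define G where "G = insert {u, v} (F - {e})"
  have sub: "F - H - {{a, b}} \<subseteq> G" "F - {{a, b}} \<subseteq> G" unfolding G_def ab by auto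
  have "joined G u v" by (rule joined_edge) (simp add: G_def)
  moreover have "joined G u a \<and> joined G b v \<or> joined G u b \<and> joined G a v"
    using joined_delete_edge[OF eH(1), of a b] eH(2) joined_mono[OF _ sub(1)]
    unfolding ab by blast
  ultimately have ab_joined: "joined G a b" by (meson joined_sym joined_trans)
  have "joined G y z" if "y \<in> V" "z \<in> V" for y z
  proof -
    have "joined F y z" using conn that unfolding connected_graph_iff_joined by blast
    from joined_delete_edge[OF this, of a b] show ?thesis
      using ab_joined joined_mono[OF _ sub(2)] by (meson joined_sym joined_trans)
  qed
  then have "connected_graph V G" unfolding connected_graph_iff_joined by blast
  moreover have GK: "G \<subseteq> complete_graph_edges V"
    using FK uv unfolding G_def complete_graph_edges_def by auto
  moreover have finG: "finite G" unfolding G_def using finF by simp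
  ultimately obtain T where T: "T \<subseteq> G" "is_spanning_tree V T"
    using connected_graph_contains_spanning_tree by metis
  have "?w T \<le> ?w G"
    by (rule sum_mono2[OF finG T(1)]) (use GK edge_length_nonneg in blast)
  also have "\<dots> \<le> edge_length x {u, v} + ?w (F - {e})"
    unfolding G_def using finF edge_length_pair[of x u v]
    by (cases "{u, v} \<in> F - {e}") (auto simp: insert_absorb)
  also have "\<dots> < edge_length x e + ?w (F - {e})"
    using short e(2) by (simp add: edge_length_pair)
  also have "\<dots> = ?w F" using e(1) finF by (simp add: sum.remove)
  finally show False using min[OF T(2)] by simp
qed

text \<open>
  This turns a count of long tree edges into a packing of the space: one vertex is taken from each
  component that remains when the long edges are removed.
\<close>

lemma long_edges_give_separated_vertices:
  assumes "finite V" "V \<noteq> {}" "is_min_spanning_tree x V F"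
  shows "\<exists>R\<subseteq>V. card R = Suc (card {e\<in>F. \<epsilon> \<le> edge_length x e}) \<and>
    (\<forall>u\<in>R. \<forall>v\<in>R. u \<noteq> v \<longrightarrow> \<epsilon> \<le> dist (x u) (x v))"
proof -
  let ?D = "{e\<in>F. \<epsilon> \<le> edge_length x e}"
  have tree: "is_spanning_tree V F" using assms(3) unfolding is_min_spanning_tree_def by blast
  then have "finite F" using assms(1) is_spanning_tree_finite by blast
  then have "\<exists>R\<subseteq>V. card R = Suc (card ?D) \<and> (\<forall>u\<in>R. \<forall>v\<in>R. joined (F - ?D) u v \<longrightarrow> u = v)"
    using assms(1,2) tree
    by (intro forest_components_after_deletion) (auto simp: is_spanning_tree_def)
  then obtain R where R: "R \<subseteq> V" "card R = Suc (card ?D)"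
    "\<And>u v. u \<in> R \<Longrightarrow> v \<in> R \<Longrightarrow> joined (F - ?D) u v \<Longrightarrow> u = v"
    by blast
  have "\<epsilon> \<le> dist (x u) (x v)" if "u \<in> R" "v \<in> R" "u \<noteq> v" for u v
    using that R min_spanning_tree_cut[OF assms(1,3)] by blast
  then show ?thesis using R(1,2) by (intro exI[of _ R]) simp
qed

section \<open>Isolated points and long tree edges\<close>

text \<open>
  An isolated vertex lies on some tree edge, which must be long, and an edge serves at most two
  vertices.
\<close>

lemma isolated_vertices_force_long_edges:
  assumes "finite V" "is_spanning_tree V F" "card V \<ge> 2" "I \<subseteq> V"
    and isolated: "\<And>i j. i \<in> I \<Longrightarrow> j \<in> V \<Longrightarrow> i \<noteq> j \<Longrightarrow> \<epsilon> \<le> dist (x i) (x j)"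
  shows "card I \<le> 2 * card {e\<in>F. \<epsilon> \<le> edge_length x e}"
proof -
  let ?L = "{e\<in>F. \<epsilon> \<le> edge_length x e}"
  have FK: "F \<subseteq> complete_graph_edges V" and conn: "connected_graph V F"
    using assms(2) unfolding is_spanning_tree_def by auto
  have finF: "finite F" using is_spanning_tree_finite[OF assms(1,2)] .
  have "i \<in> \<Union>?L" if i: "i \<in> I" for i
  proof -
    have "\<exists>j\<in>V. j \<noteq> i"
    proof (rule ccontr)
      assume "\<not> ?thesis"
      then have "V \<subseteq> {i}" by blast
      then show False using assms(3) card_mono[of "{i}" V] by simp
    qed
    then obtain j where "j \<in> V" "j \<noteq> i" by blast
    then have "joined F i j" using conn i assms(4) unfolding connected_graph_iff_joined by blast
    then obtain k where k: "{i, k} \<in> F" using \<open>j \<noteq> i\<close> 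
      unfolding joined_def by (auto elim: converse_rtranclE)
    then have "{i, k} \<in> complete_graph_edges V" using FK by blast
    then have "k \<in> V" "i \<noteq> k" unfolding complete_graph_edges_def
      by (auto simp: doubleton_eq_iff)
    then have "{i, k} \<in> ?L" using k isolated[OF i] by (simp add: edge_length_pair)
    then show ?thesis by blast
  qed
  then have "card I \<le> card (\<Union>?L)"
    using finF FK assms(1) by (intro card_mono) (auto simp: complete_graph_edges_def intro: finite_subset)
  also have "\<dots> \<le> (\<Sum>e\<in>?L. card e)" by (rule card_Union_le_sum_card)
  also have "\<dots> \<le> (\<Sum>e\<in>?L. 2)"
    using FK by (intro sum_mono) (auto simp: complete_graph_edges_def)
  finally show ?thesis by simp
qed

text \<open>
  Let \<open>j\<close> be bad if some earlier point lies within \<open>\<epsilon>\<close> of it. Two good points are at least \<open>\<epsilon>\<close>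
  apart, so if a good point is not isolated at scale \<open>\<epsilon> / 2\<close>, then its neighbour is bad, and a bad point
  can be such a neighbour of one good point only. Halving the scale thus bounds the
  non-isolated points by twice the bad ones, for whose number sequential independence gives a
  strong estimate.
\<close>

lemma nonisolated_le_twice_near_earlier:
  fixes x :: "nat \<Rightarrow> 'a::metric_space"
  assumes "finite V"
  shows "card {i\<in>V. \<exists>j\<in>V. j \<noteq> i \<and> dist (x i) (x j) < \<epsilon> / 2}
    \<le> 2 * card {j\<in>V. \<exists>i\<in>V. i < j \<and> dist (x i) (x j) < \<epsilon>}"
    (is "card ?N \<le> 2 * card ?B")
proof -
  have fin: "finite ?B" "finite ?N" using assms by auto
  have "\<forall>i\<in>?N - ?B. \<exists>j. j \<in> V \<and> j \<noteq> i \<and> dist (x i) (x j) < \<epsilon> / 2" by blast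
  from bchoice[OF this] obtain h
    where h: "\<And>i. i \<in> ?N - ?B \<Longrightarrow> h i \<in> V \<and> h i \<noteq> i \<and> dist (x i) (x (h i)) < \<epsilon> / 2"
    by blast
  have pos: "\<epsilon> > 0" if "dist y z < \<epsilon> / 2" for y z :: 'a
    using that zero_le_dist[of y z] by linarith
  have B: "h i \<in> ?B" if i: "i \<in> ?N - ?B" for i
  proof -
    have near: "dist (x i) (x (h i)) < \<epsilon>" using h[OF i] pos by fastforce
    have "\<not> h i < i" using i h[OF i] near by (auto simp: dist_commute)
    then have "i < h i" using h[OF i] by linarith
    then show ?thesis using i h[OF i] near by blast
  qed
  \<comment> \<open>Two good points with the same neighbour would be less than \<open>\<epsilon>\<close> apart.\<close>
  have "inj_on h (?N - ?B)"
  proof (rule linorder_inj_onI)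
    fix i k assume ik: "i < k" "i \<in> ?N - ?B" "k \<in> ?N - ?B"
    show "h i \<noteq> h k"
    proof
      assume "h i = h k"
      then have "dist (x i) (x k) < \<epsilon>"
        using h[OF ik(2)] h[OF ik(3)] dist_triangle2[of "x i" "x k" "x (h i)"] by simp
      then show False using ik by blast
    qed
  qed auto
  then have "card (?N - ?B) \<le> card ?B" using B fin by (intro card_inj_on_le) auto
  moreover have "card ?N \<le> card (?N - ?B) + card ?B"
  proof -
    have "card ?N \<le> card ((?N - ?B) \<union> ?B)" by (rule card_mono) (use fin in auto)
    also have "\<dots> \<le> card (?N - ?B) + card ?B" by (rule card_Un_le)
    finally show ?thesis .
  qed
  ultimately show ?thesis by linarith
qed

section \<open>Packing in the support of an Ahlfors regular measure\<close>

lemma closed_measure_support: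
  assumes "sets \<mu> = sets borel"
  shows "closed (measure_support \<mu>)"
proof -
  have "open (- measure_support \<mu>)"
    unfolding open_contains_ball
  proof
    fix u assume "u \<in> - measure_support \<mu>"
    then obtain r where r: "r > 0" "emeasure \<mu> (ball u r) = 0"
      unfolding measure_support_def by auto
    have "v \<in> - measure_support \<mu>" if v: "v \<in> ball u r" for v
    proof -
      have "ball v (r - dist u v) \<subseteq> ball u r"
      proof
        fix w assume "w \<in> ball v (r - dist u v)"
        then show "w \<in> ball u r" using dist_triangle[of u w v] by simp
      qed
      then have "emeasure \<mu> (ball v (r - dist u v)) \<le> emeasure \<mu> (ball u r)"
        by (rule emeasure_mono) (simp add: assms)
      then show ?thesis using r v unfolding measure_support_def
        by (auto intro!: exI[of _ "r - dist u v"])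
    qed
    then show "\<exists>e>0. ball u e \<subseteq> - measure_support \<mu>" using r(1) by blast
  qed
  then show ?thesis by (simp add: closed_def)
qed

text \<open>
  The balls of radius \<open>\<epsilon> / 2\<close> around \<open>\<epsilon>\<close>-separated points are disjoint.
\<close>

lemma packing_bound:
  assumes "prob_space \<mu>" "sets \<mu> = sets borel" "finite A"
    and sep: "\<And>u v. u \<in> A \<Longrightarrow> v \<in> A \<Longrightarrow> u \<noteq> v \<Longrightarrow> \<epsilon> \<le> dist u v"
    and mass: "\<And>a. a \<in> A \<Longrightarrow> m \<le> measure \<mu> (ball a (\<epsilon> / 2))"
  shows "real (card A) * m \<le> 1"
proof -
  interpret prob_space \<mu> by fact
  have "disjoint_family_on (\<lambda>a. ball a (\<epsilon> / 2)) A"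
    unfolding disjoint_family_on_def
  proof (intro ballI impI, rule ccontr)
    fix u v assume uv: "u \<in> A" "v \<in> A" "u \<noteq> v" "ball u (\<epsilon> / 2) \<inter> ball v (\<epsilon> / 2) \<noteq> {}"
    then obtain w where "dist u w < \<epsilon> / 2" "dist v w < \<epsilon> / 2" by auto
    then have "dist u v < \<epsilon>" using dist_triangle2[of u v w] by simp
    with sep[OF uv(1-3)] show False by simp
  qed
  then have "(\<Sum>a\<in>A. measure \<mu> (ball a (\<epsilon> / 2))) = measure \<mu> (\<Union>a\<in>A. ball a (\<epsilon> / 2))"
    by (intro finite_measure_finite_Union[symmetric]) (simp_all add: assms(2,3) image_subset_iff)
  also have "\<dots> \<le> 1" by (rule prob_le_1)
  finally have "(\<Sum>a\<in>A. measure \<mu> (ball a (\<epsilon> / 2))) \<le> 1" .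
  moreover have "real (card A) * m \<le> (\<Sum>a\<in>A. measure \<mu> (ball a (\<epsilon> / 2)))"
    using sum_bounded_below[of A m "\<lambda>a. measure \<mu> (ball a (\<epsilon> / 2))"] mass by simp
  ultimately show ?thesis by simp
qed

text \<open>
  A separated set of largest possible size is a net.
\<close>

lemma finite_net_if_packing_bounded:
  fixes X :: "'a::metric_space set"
  assumes bound: "\<And>A. finite A \<Longrightarrow> A \<subseteq> X \<Longrightarrow> (\<And>u v. u \<in> A \<Longrightarrow> v \<in> A \<Longrightarrow> u \<noteq> v \<Longrightarrow> \<epsilon> \<le> dist u v) \<Longrightarrow>
    card A \<le> N"
    and "\<epsilon> > 0"
  shows "\<exists>A. finite A \<and> A \<subseteq> X \<and> (\<forall>y\<in>X. \<exists>a\<in>A. dist a y < \<epsilon>)"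
proof -
  define Q where "Q A \<longleftrightarrow> finite A \<and> A \<subseteq> X \<and> (\<forall>u\<in>A. \<forall>v\<in>A. u \<noteq> v \<longrightarrow> \<epsilon> \<le> dist u v)" for A
  have "Q {}" unfolding Q_def by simp
  moreover have "\<forall>A. Q A \<longrightarrow> card A < Suc N"
    using bound unfolding Q_def by (auto simp: less_Suc_eq_le)
  ultimately obtain A where A: "Q A" "\<And>B. Q B \<Longrightarrow> card B \<le> card A"
    using ex_has_greatest_nat[of Q "{}" card "Suc N"] by blast
  have "\<exists>a\<in>A. dist a y < \<epsilon>" if y: "y \<in> X" for y
  proof (rule ccontr)
    assume far: "\<not> (\<exists>a\<in>A. dist a y < \<epsilon>)"
    then have "y \<notin> A" using assms(2) by auto
    have "Q (insert y A)" using A(1) far y unfolding Q_def by (auto simp: dist_commute not_less)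
    from A(2)[OF this] show False using A(1) \<open>y \<notin> A\<close> unfolding Q_def by simp
  qed
  then show ?thesis using A(1) unfolding Q_def by (intro exI[of _ A]) auto
qed

lemma ahlfors_support_finite_net:
  assumes reg: "ahlfors_regular d \<mu>" and "\<epsilon> > 0"
  shows "\<exists>A. finite A \<and> A \<subseteq> measure_support \<mu> \<and> (\<forall>y\<in>measure_support \<mu>. \<exists>a\<in>A. dist a y < \<epsilon>)"
proof -
  obtain c \<delta>0 where c: "c > 0" "\<delta>0 > 0" and lower: "\<And>u \<delta>. u \<in> measure_support \<mu> \<Longrightarrow> 0 < \<delta> \<Longrightarrow>
      \<delta> < \<delta>0 \<Longrightarrow> 1 / c * \<delta> powr d \<le> measure \<mu> (ball u \<delta>)"
    and \<mu>: "prob_space \<mu>" "sets \<mu> = sets borel"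
    using reg unfolding ahlfors_regular_def by blast
  interpret prob_space \<mu> by fact
  define r where "r = min (\<epsilon> / 2) (\<delta>0 / 2)"
  define m where "m = 1 / c * r powr d"
  have r: "0 < r" "r < \<delta>0" "r \<le> \<epsilon> / 2" using c assms(2) unfolding r_def by auto
  have m: "m > 0" using c r unfolding m_def by simp
  show ?thesis
  proof (rule finite_net_if_packing_bounded[OF _ assms(2), where N = "nat \<lfloor>1 / m\<rfloor>"])
    fix A assume A: "finite A" "A \<subseteq> measure_support \<mu>"
      and sep: "\<And>u v. u \<in> A \<Longrightarrow> v \<in> A \<Longrightarrow> u \<noteq> v \<Longrightarrow> \<epsilon> \<le> dist u v"
    have "m \<le> measure \<mu> (ball a (\<epsilon> / 2))" if "a \<in> A" for a
    proof -
      have "m \<le> measure \<mu> (ball a r)" unfolding m_def using lower[of a r] r A(2) that by auto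
      also have "\<dots> \<le> measure \<mu> (ball a (\<epsilon> / 2))"
        using r by (intro finite_measure_mono subset_ball) (simp_all add: \<mu>(2))
      finally show ?thesis .
    qed
    from packing_bound[OF \<mu> A(1) sep this] have "real (card A) * m \<le> 1" .
    then have "real (card A) \<le> 1 / m" using m by (simp add: field_simps)
    then show "card A \<le> nat \<lfloor>1 / m\<rfloor>" by linarith
  qed
qed

lemma ahlfors_support_bounded:
  assumes "ahlfors_regular d \<mu>"
  shows "bounded (measure_support \<mu>)"
proof -
  obtain A where A: "finite A" "\<forall>y\<in>measure_support \<mu>. \<exists>a\<in>A. dist a y < 1"
    using ahlfors_support_finite_net[OF assms zero_less_one] by blast
  have "bounded (\<Union>a\<in>A. ball a 1)" using A(1) by (intro bounded_UN) auto
  then show ?thesis by (rule bounded_subset) (use A(2) in auto)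
qed

lemma ahlfors_support_separable:
  assumes "ahlfors_regular d \<mu>"
  obtains D where "countable D"
    "\<And>y \<epsilon>. y \<in> measure_support \<mu> \<Longrightarrow> \<epsilon> > 0 \<Longrightarrow> \<exists>q\<in>D. dist q y < \<epsilon>"
proof -
  define net where "net n A \<longleftrightarrow> finite A \<and> A \<subseteq> measure_support \<mu> \<and>
    (\<forall>y\<in>measure_support \<mu>. \<exists>a\<in>A. dist a y < inverse (real (Suc n)))" for n A
  have "\<exists>A. net n A" for n
    unfolding net_def by (intro ahlfors_support_finite_net[OF assms]) simp
  then have "\<exists>A. \<forall>n. net n (A n)" by (intro choice allI)
  then obtain A where "\<forall>n. net n (A n)" ..
  then have A: "net n (A n)" for n by simp
  show thesis
  proof (rule that[of "\<Union>n. A n"])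
    show "countable (\<Union>n. A n)"
      using A unfolding net_def by (intro countable_UN) (auto intro: countable_finite)
    fix y \<epsilon> assume y: "y \<in> measure_support \<mu>" and "(\<epsilon>::real) > 0"
    then obtain n where "inverse (real (Suc n)) < \<epsilon>" using reals_Archimedean by blast
    with A[of n] y show "\<exists>q\<in>\<Union>n. A n. dist q y < \<epsilon>"
      unfolding net_def by (meson UNIV_I UN_I order.strict_trans)
  qed
qed

text \<open>
  The regularity condition speaks of small radii only. Since the support is bounded, the
  lower bound on the mass of a ball extends to all radii that can occur as distances, with a
  smaller constant. With two points in \<open>A\<close>, \<open>\<epsilon>\<close> is at most such a distance.
\<close>

lemma ahlfors_packing:
  assumes reg: "ahlfors_regular d \<mu>"
  obtains b where "b > 0"
    "\<And>A \<epsilon>. finite A \<Longrightarrow> A \<subseteq> measure_support \<mu> \<Longrightarrow> 2 \<le> card A \<Longrightarrow> 0 < \<epsilon> \<Longrightarrow>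
      (\<And>u v. u \<in> A \<Longrightarrow> v \<in> A \<Longrightarrow> u \<noteq> v \<Longrightarrow> \<epsilon> \<le> dist u v) \<Longrightarrow> real (card A) * (b * \<epsilon> powr d) \<le> 1"
proof -
  let ?X = "measure_support \<mu>"
  obtain c \<delta>0 where c: "c > 0" "\<delta>0 > 0" and lower: "\<And>u \<delta>. u \<in> ?X \<Longrightarrow> 0 < \<delta> \<Longrightarrow>
      \<delta> < \<delta>0 \<Longrightarrow> 1 / c * \<delta> powr d \<le> measure \<mu> (ball u \<delta>)"
    and \<mu>: "prob_space \<mu>" "sets \<mu> = sets borel"
    using reg unfolding ahlfors_regular_def by blast
  interpret prob_space \<mu> by fact
  obtain K where K: "K > 0" "\<And>u v. u \<in> ?X \<Longrightarrow> v \<in> ?X \<Longrightarrow> dist u v \<le> K"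
  proof -
    obtain K where "\<And>u v. u \<in> ?X \<Longrightarrow> v \<in> ?X \<Longrightarrow> dist u v \<le> K"
      using ahlfors_support_bounded[OF reg] unfolding bounded_two_points by blast
    then show thesis by (intro that[of "max K 1"]) (auto intro: le_max_iff_disj[THEN iffD2])
  qed
  \<comment> \<open>Scaling by \<open>\<kappa>\<close> brings every distance \<open>\<epsilon> \<le> K\<close> into the range of the regularity condition and
    below \<open>\<epsilon> / 2\<close>.\<close>
  define \<kappa> where "\<kappa> = min (1 / 2) (\<delta>0 / (2 * K))"
  have \<kappa>: "0 < \<kappa>" "\<kappa> \<le> 1 / 2" "\<kappa> * K < \<delta>0"
  proof -
    have "\<kappa> * K \<le> \<delta>0 / (2 * K) * K" unfolding \<kappa>_def using K(1) by (intro mult_right_mono) auto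
    then show "\<kappa> * K < \<delta>0" using K(1) c by simp
  qed (use c K(1) in \<open>auto simp: \<kappa>_def\<close>)
  show thesis
  proof (rule that[of "1 / c * \<kappa> powr d"])
    show "1 / c * \<kappa> powr d > 0" using c \<kappa> by simp
    fix A \<epsilon> assume A: "finite A" "A \<subseteq> ?X" "2 \<le> card A" and \<epsilon>: "0 < (\<epsilon>::real)"
      and sep: "\<And>u v. u \<in> A \<Longrightarrow> v \<in> A \<Longrightarrow> u \<noteq> v \<Longrightarrow> \<epsilon> \<le> dist u v"
    obtain u v where "u \<in> A" "v \<in> A" "u \<noteq> v"
      using A(3) by (auto simp: numeral_2_eq_2 card_le_Suc_iff)
    then have "\<epsilon> \<le> K" using sep K(2) A(2) by (meson order_trans subsetD)
    then have "\<kappa> * \<epsilon> \<le> \<kappa> * K" using \<kappa> by simp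
    then have "\<kappa> * \<epsilon> < \<delta>0" using \<kappa>(3) by simp
    then have r: "0 < \<kappa> * \<epsilon>" "\<kappa> * \<epsilon> < \<delta>0" "\<kappa> * \<epsilon> \<le> \<epsilon> / 2"
      using \<kappa> \<epsilon> mult_right_mono[OF \<kappa>(2), of \<epsilon>] by auto
    have "1 / c * \<kappa> powr d * \<epsilon> powr d \<le> measure \<mu> (ball a (\<epsilon> / 2))" if "a \<in> A" for a
    proof -
      have "1 / c * (\<kappa> * \<epsilon>) powr d \<le> measure \<mu> (ball a (\<kappa> * \<epsilon>))"
        using lower[of a "\<kappa> * \<epsilon>"] r A(2) that by auto
      also have "\<dots> \<le> measure \<mu> (ball a (\<epsilon> / 2))"
        using r by (intro finite_measure_mono subset_ball) (simp_all add: \<mu>(2))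
      finally show ?thesis using \<kappa> \<epsilon> by (simp add: powr_mult)
    qed
    then show "real (card A) * (1 / c * \<kappa> powr d * \<epsilon> powr d) \<le> 1"
      by (intro packing_bound[OF \<mu> A(1) sep]) auto
  qed
qed

section \<open>Power sums under a bound on the number of large terms\<close>

text \<open>
  The mean value theorem; the increments on the right telescope, which yields
  \<open>(1 - s) \<Sum>\<^sub>k k\<^sup>-\<^sup>s \<le> n\<^sup>1\<^sup>-\<^sup>s\<close>.
\<close>

lemma powr_increment_ge:
  fixes s :: real
  assumes "0 < s" "s < 1"
  shows "(1 - s) * real (Suc k) powr (- s) \<le> real (Suc k) powr (1 - s) - real k powr (1 - s)"
proof (cases "k = 0")
  case True
  then show ?thesis using assms by simp
next
  case False
  have deriv: "((\<lambda>t. t powr (1 - s)) has_real_derivative (1 - s) * t powr (- s)) (at t)"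
    if "real k \<le> t" for t
    using that False by (auto intro!: derivative_eq_intros)
  obtain z where z: "real k < z" "z < real (Suc k)"
    "real (Suc k) powr (1 - s) - real k powr (1 - s) =
      (real (Suc k) - real k) * ((1 - s) * z powr (- s))"
    using MVT2[of "real k" "real (Suc k)" "\<lambda>t. t powr (1 - s)" "\<lambda>t. (1 - s) * t powr (- s)"] deriv
    by auto
  have "real (Suc k) powr (- s) \<le> z powr (- s)"
    using z(1,2) assms by (intro powr_mono2') auto
  then show ?thesis using z(3) assms by simp
qed

text \<open>
  The \<open>k\<close>-th largest value is at most \<open>(b k)\<^sup>-\<^sup>1\<^sup>/\<^sup>d\<close> by the count at that value, so the sum is bounded
  by a multiple of \<open>\<Sum>\<^sub>k k\<^sup>-\<^sup>\<alpha>\<^sup>/\<^sup>d\<close>; this is where \<open>\<alpha> < d\<close> enters. The induction removes the smallest value,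
  for which the count is the size of the whole set.
\<close>

lemma sum_powr_le_of_count_bound:
  fixes l :: "'e \<Rightarrow> real"
  assumes "finite F" "d > 0" "0 < \<alpha>" "\<alpha> < d" "b > 0"
    and count: "\<And>\<epsilon>. \<epsilon> > 0 \<Longrightarrow> real (card {e\<in>F. \<epsilon> \<le> l e}) * (b * \<epsilon> powr d) \<le> 1"
    and "\<And>e. e \<in> F \<Longrightarrow> 0 \<le> l e"
  shows "(\<Sum>e\<in>F. l e powr \<alpha>) \<le> b powr (- (\<alpha> / d)) / (1 - \<alpha> / d) * real (card F) powr (1 - \<alpha> / d)"
  using assms(1) count assms(7)
proof (induction "card F" arbitrary: F)
  case 0
  then show ?case by simp
next
  case (Suc k)
  define s where "s = \<alpha> / d"
  define C where "C = b powr (- s) / (1 - s)"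
  have s: "0 < s" "s < 1" using assms(2-4) unfolding s_def by auto
  have "F \<noteq> {}" using Suc.hyps(2) by auto
  obtain e where e: "e \<in> F" "\<And>e'. e' \<in> F \<Longrightarrow> l e \<le> l e'"
    using ex_min_if_finite[of "l ` F"] Suc.prems(1) \<open>F \<noteq> {}\<close> by (force simp: not_less)
  have k: "card (F - {e}) = k" using Suc.hyps(2) e(1) Suc.prems(1) by simp
  have IH: "(\<Sum>e\<in>F - {e}. l e powr \<alpha>) \<le> C * real k powr (1 - s)"
    unfolding C_def s_def k[symmetric]
  proof (rule Suc.hyps(1))
    fix \<epsilon> :: real assume \<epsilon>: "\<epsilon> > 0"
    have "card {e'\<in>F - {e}. \<epsilon> \<le> l e'} \<le> card {e'\<in>F. \<epsilon> \<le> l e'}"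
      using Suc.prems(1) by (intro card_mono) auto
    then have "real (card {e'\<in>F - {e}. \<epsilon> \<le> l e'}) * (b * \<epsilon> powr d) \<le>
        real (card {e'\<in>F. \<epsilon> \<le> l e'}) * (b * \<epsilon> powr d)"
      using assms(5) by (intro mult_right_mono) auto
    with Suc.prems(2)[OF \<epsilon>] show "real (card {e'\<in>F - {e}. \<epsilon> \<le> l e'}) * (b * \<epsilon> powr d) \<le> 1" by simp
  qed (use Suc.prems k in auto)
  have "l e powr \<alpha> \<le> b powr (- s) * real (Suc k) powr (- s)"
  proof (cases "l e = 0")
    case False
    then have pos: "l e > 0" using Suc.prems(3) e(1) by (simp add: order_less_le)
    have "{e'\<in>F. l e \<le> l e'} = F" using e by auto
    then have "real (Suc k) * (b * l e powr d) \<le> 1" using Suc.prems(2)[OF pos] Suc.hyps(2) by simp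
    then have "l e powr d \<le> 1 / (b * real (Suc k))"
      using assms(5) by (subst pos_le_divide_eq) (simp_all add: algebra_simps add_pos_nonneg)
    then have "(l e powr d) powr s \<le> (1 / (b * real (Suc k))) powr s"
      using s by (intro powr_mono2) auto
    also have "\<dots> = b powr (- s) * real (Suc k) powr (- s)"
      using assms(5) by (simp add: powr_divide powr_mult powr_minus_divide)
    finally show ?thesis using pos assms(2) by (simp add: powr_powr s_def)
  qed (use assms(5) in simp)
  moreover have "C * real (Suc k) powr (1 - s) =
      C * real k powr (1 - s) + C * (real (Suc k) powr (1 - s) - real k powr (1 - s))"
    by (simp add: algebra_simps)
  moreover have "b powr (- s) * real (Suc k) powr (- s) =
      C * ((1 - s) * real (Suc k) powr (- s))"
    unfolding C_def using s by simp
  moreover have "C * ((1 - s) * real (Suc k) powr (- s)) \<le>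
      C * (real (Suc k) powr (1 - s) - real k powr (1 - s))"
    using powr_increment_ge[OF s] s unfolding C_def by (intro mult_left_mono) auto
  moreover have "(\<Sum>e\<in>F. l e powr \<alpha>) = l e powr \<alpha> + (\<Sum>e\<in>F - {e}. l e powr \<alpha>)"
    using e(1) Suc.prems(1) by (simp add: sum.remove)
  ultimately have "(\<Sum>e\<in>F. l e powr \<alpha>) \<le> C * real (Suc k) powr (1 - s)"
    using IH by linarith
  then show ?case unfolding C_def s_def Suc.hyps(2)[symmetric] .
qed

section \<open>Distances of random points in the support\<close>

text \<open>
  The ambient space may be non-separable, so that the distance need not be measurable with respect to
  the product of the Borel \<open>\<sigma>\<close>-algebras. With one argument confined to a separable set, triangle inequalities
  through a countable dense set write the event as a countable union of rectangles.
\<close>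

lemma near_pair_measurable:
  fixes X :: "'a::metric_space set"
  assumes X: "X \<in> sets borel" and D: "countable D"
    and dense: "\<And>y \<epsilon>. y \<in> X \<Longrightarrow> \<epsilon> > 0 \<Longrightarrow> \<exists>q\<in>D. dist q y < \<epsilon>"
  shows "{(u, v). u \<in> X \<and> dist u v < r} \<in> sets (borel \<Otimes>\<^sub>M borel)"
proof -
  have "{(u, v). u \<in> X \<and> dist u v < r} = (\<Union>q\<in>D. \<Union>s\<in>\<rat>. (X \<inter> ball q s) \<times> ball q (r - s))"
    (is "?L = ?R")
  proof (intro equalityI subsetI)
    fix w assume "w \<in> ?L"
    then obtain u v where w: "w = (u, v)" "u \<in> X" "dist u v < r" by auto
    then obtain q where q: "q \<in> D" "dist q u < (r - dist u v) / 2"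
      using dense[of u "(r - dist u v) / 2"] by auto
    have "dist q v \<le> dist q u + dist u v" by (rule dist_triangle)
    then have "dist q u < r - dist q v" using q(2) by simp
    then obtain s where "s \<in> \<rat>" "dist q u < s" "s < r - dist q v"
      using Rats_dense_in_real by blast
    then have "w \<in> (X \<inter> ball q s) \<times> ball q (r - s)" using w by auto
    then show "w \<in> ?R" using q(1) \<open>s \<in> \<rat>\<close> by blast
  next
    fix w assume "w \<in> ?R"
    then obtain q s where qs: "w \<in> (X \<inter> ball q s) \<times> ball q (r - s)" by blast
    then obtain u v where w: "w = (u, v)" "u \<in> X" "dist q u < s" "dist q v < r - s" by auto
    then show "w \<in> ?L" using dist_triangle3[of u v q] by auto
  qed
  moreover have "?R \<in> sets (borel \<Otimes>\<^sub>M borel)"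
    using X
    by (intro sets.countable_UN'[OF D] sets.countable_UN'[OF countable_rat] pair_measureI sets.Int image_subsetI) auto
  ultimately show ?thesis by simp
qed

lemma ahlfors_support_sets:
  assumes "ahlfors_regular d \<mu>"
  shows "measure_support \<mu> \<in> sets borel"
  using assms closed_measure_support unfolding ahlfors_regular_def by (metis borel_closed)

section \<open>Samples from an Ahlfors regular measure\<close>

locale ahlfors_sample = prob_space P
  for P :: "'b measure" +
  fixes \<mu> :: "'a::metric_space measure" and x :: "nat \<Rightarrow> 'b \<Rightarrow> 'a" and d :: real
  assumes dim_pos: "d > 0"
    and regular: "ahlfors_regular d \<mu>"
    and indep: "indep_vars (\<lambda>_. borel) x UNIV"
    and distributed: "distr P borel (x j) = \<mu>"
begin

abbreviation X :: "'a set" where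
  "X \<equiv> measure_support \<mu>"

lemma X_sets [measurable]: "X \<in> sets borel"
  using ahlfors_support_sets[OF regular] .

lemma sets_\<mu>: "sets \<mu> = sets borel"
  using regular unfolding ahlfors_regular_def by blast

lemma x_measurable [measurable]: "x j \<in> borel_measurable P"
  using indep unfolding indep_vars_def2 by blast

definition sampled_in_support :: "'b set" where
  "sampled_in_support = {\<omega> \<in> space P. \<forall>j. x j \<omega> \<in> X}"

lemma sampled_in_support_events: "sampled_in_support \<in> events"
  unfolding sampled_in_support_def by measurable

lemma AE_sampled_in_support: "AE \<omega> in P. \<omega> \<in> sampled_in_support"
proof -
  have "AE \<omega> in P. x j \<omega> \<in> X" for j
  proof -
    have "emeasure P (x j -` X \<inter> space P) = emeasure (distr P borel (x j)) X"
      by (rule emeasure_distr[symmetric]) auto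
    also have "\<dots> = emeasure \<mu> X" by (simp only: distributed)
    also have "\<dots> = 1" using regular unfolding ahlfors_regular_def by blast
    finally have "prob (x j -` X \<inter> space P) = 1" by (simp add: measure_def)
    then show ?thesis by (subst (asm) prob_eq_1) auto
  qed
  then have "AE \<omega> in P. \<forall>j. x j \<omega> \<in> X" by (simp add: AE_all_countable)
  then show ?thesis unfolding sampled_in_support_def using AE_space by eventually_elim simp
qed

lemma near_pair_sets [measurable]: "{(u, v). u \<in> X \<and> dist u v < r} \<in> sets (borel \<Otimes>\<^sub>M borel)"
proof -
  obtain D where "countable D" "\<And>y \<epsilon>. y \<in> X \<Longrightarrow> \<epsilon> > 0 \<Longrightarrow> \<exists>q\<in>D. dist q y < \<epsilon>"
    using ahlfors_support_separable[OF regular] by metis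
  then show ?thesis by (rule near_pair_measurable[OF X_sets])
qed

lemma near_pred:
  assumes "f \<in> borel_measurable M" "g \<in> borel_measurable M"
  shows "Measurable.pred M (\<lambda>w. f w \<in> X \<and> dist (f w) (g w) < r)"
proof -
  have "(\<lambda>w. (f w, g w)) \<in> M \<rightarrow>\<^sub>M borel \<Otimes>\<^sub>M borel" using assms by (rule measurable_Pair)
  from measurable_sets[OF this near_pair_sets[of r]] show ?thesis
    unfolding pred_def by (simp add: vimage_def Int_def conj_commute)
qed

text \<open>
  The indices start at \<open>1\<close> because the vertices are \<open>1, \<dots>, n\<close>. The condition \<open>y i \<in> X\<close> makes the event
  measurable and keeps the ball around \<open>y i\<close> subject to the regularity bound; it holds almost surely.
\<close>

definition near_earlier :: "real \<Rightarrow> (nat \<Rightarrow> 'a) \<Rightarrow> nat \<Rightarrow> bool" where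
  "near_earlier \<epsilon> y j \<longleftrightarrow> (\<exists>i\<in>{1..<j}. y i \<in> X \<and> dist (y i) (y j) < \<epsilon>)"

lemma near_earlier_pred:
  assumes "\<And>i. i \<le> j \<Longrightarrow> (\<lambda>w. f w i) \<in> borel_measurable M"
  shows "Measurable.pred M (\<lambda>w. near_earlier \<epsilon> (f w) j)"
  unfolding near_earlier_def
  by (intro pred_intros_finite near_pred assms) auto

section \<open>Few points are close to an earlier one\<close>

text \<open>
  Given the points with smaller indices, the point with index \<open>j\<close> has to fall into a union of at most
  \<open>n\<close> balls of mass at most \<open>m\<close>. As it is independent of the
  earlier points, Fubini turns this into a factor \<open>q\<close>.
\<close>

lemma prob_near_earlier_step:
  assumes A: "A \<in> sets (PiM {..<j} (\<lambda>_. borel))"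
    and ball: "\<And>u. u \<in> X \<Longrightarrow> measure \<mu> (ball u \<epsilon>) \<le> m"
    and j: "j \<le> n" and n: "real n * m \<le> q" and "0 \<le> m"
  shows "emeasure P {\<omega> \<in> space P. restrict (\<lambda>i. x i \<omega>) {..<j} \<in> A \<and> near_earlier \<epsilon> (\<lambda>i. x i \<omega>) j}
    \<le> ennreal q * emeasure P {\<omega> \<in> space P. restrict (\<lambda>i. x i \<omega>) {..<j} \<in> A}"
proof -
  let ?M = "PiM {..<j} (\<lambda>_. borel :: 'a measure)"
  let ?Y = "\<lambda>\<omega>. restrict (\<lambda>i. x i \<omega>) {..<j}"
  let ?\<nu> = "distr P ?M ?Y"
  have Y [measurable]: "?Y \<in> P \<rightarrow>\<^sub>M ?M" by (intro measurable_restrict x_measurable)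
  let ?N = "PiM {j} (\<lambda>_. borel :: 'a measure)"
  let ?Z = "\<lambda>\<omega>. restrict (\<lambda>i. x i \<omega>) {j}"
  let ?\<rho> = "distr P ?N ?Z"
  have Z [measurable]: "?Z \<in> P \<rightarrow>\<^sub>M ?N" by (intro measurable_restrict x_measurable)
  have "indep_var ?M ?Y ?N ?Z"
    by (rule indep_var_restrict[OF indep]) auto
  then have joint: "?\<nu> \<Otimes>\<^sub>M ?\<rho> = distr P (?M \<Otimes>\<^sub>M ?N) (\<lambda>\<omega>. (?Y \<omega>, ?Z \<omega>))"
    by (simp add: indep_var_distribution_eq)
  interpret \<rho>: prob_space ?\<rho> by (rule prob_space_distr) (rule Z)
  have coord: "(\<lambda>f. f j) \<in> ?N \<rightarrow>\<^sub>M borel" by (rule measurable_component_singleton) simp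
  then have marginal: "distr ?\<rho> borel (\<lambda>f. f j) = \<mu>"
    by (subst distr_distr) (auto simp: comp_def distributed)
  interpret \<mu>: prob_space \<mu> using regular unfolding ahlfors_regular_def by blast
  define E where "E = {w \<in> space (?M \<Otimes>\<^sub>M ?N). fst w \<in> A \<and>
    (\<exists>i\<in>{1..<j}. fst w i \<in> X \<and> dist (fst w i) (snd w j) < \<epsilon>)}"
  have [measurable]: "A \<in> sets ?M" by fact
  have "Measurable.pred (?M \<Otimes>\<^sub>M ?N) (\<lambda>w. \<exists>i\<in>{1..<j}. fst w i \<in> X \<and> dist (fst w i) (snd w j) < \<epsilon>)"
    by (intro pred_intros_finite near_pred) (auto intro: measurable_component_singleton[THEN measurable_compose[rotated]])
  then have E: "E \<in> sets (?M \<Otimes>\<^sub>M ?N)" unfolding E_def by measurable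
  have fibre: "emeasure ?\<rho> (Pair u -` E) \<le> ennreal q * indicator A u" for u
  proof (cases "u \<in> A")
    case False
    then have "Pair u -` E = {}" unfolding E_def by auto
    then show ?thesis by simp
  next
    case True
    let ?I = "{i \<in> {1..<j}. u i \<in> X}"
    let ?B = "\<Union>i\<in>?I. ball (u i) \<epsilon>"
    have "open ?B" by auto
    have "Pair u -` E \<subseteq> (\<lambda>f. f j) -` ?B \<inter> space ?\<rho>"
      unfolding E_def by (auto simp: space_pair_measure)
    then have "emeasure ?\<rho> (Pair u -` E) \<le> emeasure ?\<rho> ((\<lambda>f. f j) -` ?B \<inter> space ?\<rho>)"
      by (intro emeasure_mono measurable_sets[of _ _ borel]) (use coord \<open>open ?B\<close> in auto)
    also have "\<dots> = emeasure \<mu> ?B"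
      using coord \<open>open ?B\<close> unfolding marginal[symmetric] by (subst emeasure_distr) auto
    also have "\<dots> \<le> ennreal (\<Sum>i\<in>?I. measure \<mu> (ball (u i) \<epsilon>))"
      unfolding \<mu>.emeasure_eq_measure
      by (intro ennreal_leI \<mu>.finite_measure_subadditive_finite) (auto simp: sets_\<mu>)
    also have "(\<Sum>i\<in>?I. measure \<mu> (ball (u i) \<epsilon>)) \<le> real (card ?I) * m"
      by (rule sum_bounded_above) (use ball in auto)
    also have "\<dots> \<le> real n * m"
    proof -
      have "card ?I \<le> card {1..<j}" by (rule card_mono) auto
      then show ?thesis using j \<open>0 \<le> m\<close> by (intro mult_right_mono) auto
    qed
    also have "\<dots> \<le> q" by fact
    finally show ?thesis using True by (simp add: ennreal_leI)
  qed
  have "emeasure P {\<omega> \<in> space P. ?Y \<omega> \<in> A \<and> near_earlier \<epsilon> (\<lambda>i. x i \<omega>) j}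
      = emeasure P ((\<lambda>\<omega>. (?Y \<omega>, ?Z \<omega>)) -` E \<inter> space P)"
    using measurable_space[OF Y] measurable_space[OF Z]
    by (intro arg_cong[where f = "emeasure P"]) (auto simp: E_def near_earlier_def space_pair_measure)
  also have "\<dots> = emeasure (?\<nu> \<Otimes>\<^sub>M ?\<rho>) E"
    unfolding joint using E by (subst emeasure_distr) auto
  also have "\<dots> = (\<integral>\<^sup>+u. emeasure ?\<rho> (Pair u -` E) \<partial>?\<nu>)"
  proof (rule \<rho>.emeasure_pair_measure_alt)
    have "sets (?\<nu> \<Otimes>\<^sub>M ?\<rho>) = sets (?M \<Otimes>\<^sub>M ?N)"
      by (intro sets_pair_measure_cong) simp_all
    then show "E \<in> sets (?\<nu> \<Otimes>\<^sub>M ?\<rho>)" using E by simp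
  qed
  also have "\<dots> \<le> (\<integral>\<^sup>+u. ennreal q * indicator A u \<partial>?\<nu>)"
    by (intro nn_integral_mono fibre)
  also have "\<dots> = ennreal q * emeasure ?\<nu> A"
    by (subst nn_integral_cmult_indicator) auto
  also have "emeasure ?\<nu> A = emeasure P {\<omega> \<in> space P. ?Y \<omega> \<in> A}"
    by (subst emeasure_distr) (auto intro!: arg_cong[where f = "emeasure P"])
  finally show ?thesis .
qed

text \<open>
  Peel off the largest index of \<open>S\<close>: the remaining conditions involve earlier points only.
\<close>

lemma prob_all_near_earlier:
  assumes "finite S" "\<And>j. j \<in> S \<Longrightarrow> j \<le> n"
    and ball: "\<And>u. u \<in> X \<Longrightarrow> measure \<mu> (ball u \<epsilon>) \<le> m"
    and n: "real n * m \<le> q" and "0 \<le> m"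
  shows "emeasure P {\<omega> \<in> space P. \<forall>j\<in>S. near_earlier \<epsilon> (\<lambda>i. x i \<omega>) j} \<le> ennreal q ^ card S"
  using assms(1,2)
proof (induction S rule: finite_linorder_max_induct)
  case empty
  then show ?case by (simp add: emeasure_space_1)
next
  case (insert j S)
  let ?Y = "\<lambda>\<omega>. restrict (\<lambda>i. x i \<omega>) {..<j}"
  define A where "A = {u \<in> space (PiM {..<j} (\<lambda>_. borel)). \<forall>k\<in>S. near_earlier \<epsilon> u k}"
  have "Measurable.pred (PiM {..<j} (\<lambda>_. borel)) (\<lambda>u. \<forall>k\<in>S. near_earlier \<epsilon> u k)"
  proof (intro pred_intros_finite near_earlier_pred measurable_component_singleton)
    fix k i assume "k \<in> S" "i \<le> k"
    with insert.hyps(2) show "i \<in> {..<j}" by fastforce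
  qed (fact insert.hyps(1))
  then have A: "A \<in> sets (PiM {..<j} (\<lambda>_. borel))" unfolding A_def pred_def .
  have restrict_near: "near_earlier \<epsilon> (?Y \<omega>) k \<longleftrightarrow> near_earlier \<epsilon> (\<lambda>i. x i \<omega>) k" if "k \<in> S" for k \<omega>
    using insert.hyps(2) that unfolding near_earlier_def by force
  have Y_in_A: "?Y \<omega> \<in> A \<longleftrightarrow> (\<forall>k\<in>S. near_earlier \<epsilon> (\<lambda>i. x i \<omega>) k)" for \<omega>
    unfolding A_def using restrict_near by (simp add: space_PiM)
  have "emeasure P {\<omega> \<in> space P. \<forall>k\<in>insert j S. near_earlier \<epsilon> (\<lambda>i. x i \<omega>) k}
      = emeasure P {\<omega> \<in> space P. ?Y \<omega> \<in> A \<and> near_earlier \<epsilon> (\<lambda>i. x i \<omega>) j}"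
    unfolding Y_in_A by (intro arg_cong[where f = "emeasure P"]) auto
  also have "\<dots> \<le> ennreal q * emeasure P {\<omega> \<in> space P. ?Y \<omega> \<in> A}"
    by (rule prob_near_earlier_step[OF A ball _ n \<open>0 \<le> m\<close>]) (use insert.prems in auto)
  also have "\<dots> \<le> ennreal q * ennreal q ^ card S"
    unfolding Y_in_A using insert by (intro mult_left_mono) auto
  also have "\<dots> = ennreal q ^ card (insert j S)"
    using insert.hyps by (subst card_insert_disjoint) auto
  finally show ?case .
qed

text \<open>
  A union bound over the at most \<open>2\<^sup>n\<close> index sets \<open>S\<close> with more than \<open>n / 4\<close> elements. With
  probability at most \<open>(1 / 256) ^ card S\<close>, hence at most \<open>4\<^sup>-\<^sup>n\<close>, all indices in \<open>S\<close> belong to points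
  close to an earlier one; the constant \<open>256 = 4\<^sup>4\<close> is chosen to make the product \<open>2\<^sup>-\<^sup>n\<close>.
\<close>

lemma prob_few_near_earlier:
  assumes ball: "\<And>u. u \<in> X \<Longrightarrow> measure \<mu> (ball u \<epsilon>) \<le> m"
    and n: "real n * m \<le> 1 / 256" and "0 \<le> m"
  shows "{\<omega> \<in> space P. 4 * card {j\<in>{1..n}. near_earlier \<epsilon> (\<lambda>i. x i \<omega>) j} \<le> n} \<in> events"
      (is "?few \<in> events")
    and "prob {\<omega> \<in> space P. 4 * card {j\<in>{1..n}. near_earlier \<epsilon> (\<lambda>i. x i \<omega>) j} \<le> n} \<ge> 1 - (1 / 2) ^ n"
proof -
  define all_near where "all_near S = {\<omega> \<in> space P. \<forall>j\<in>S. near_earlier \<epsilon> (\<lambda>i. x i \<omega>) j}" for S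
  define big where "big = {S. S \<subseteq> {1..n} \<and> n < 4 * card S}"
  have fin_big: "finite big" unfolding big_def by (rule finite_subset[of _ "Pow {1..n}"]) auto
  have near: "Measurable.pred P (\<lambda>\<omega>. near_earlier \<epsilon> (\<lambda>i. x i \<omega>) j)" for j
    by (rule near_earlier_pred) measurable
  have events: "all_near S \<in> events" if "S \<in> big" for S
  proof -
    have "finite S" using that unfolding big_def by (auto intro: finite_subset)
    then have "Measurable.pred P (\<lambda>\<omega>. \<forall>j\<in>S. near_earlier \<epsilon> (\<lambda>i. x i \<omega>) j)"
      by (intro pred_intros_finite near)
    then show ?thesis unfolding all_near_def pred_def .
  qed
  have few: "?few = space P - (\<Union>S\<in>big. all_near S)"
  proof (intro equalityI subsetI)
    fix \<omega> assume \<omega>: "\<omega> \<in> ?few"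
    let ?B = "{j\<in>{1..n}. near_earlier \<epsilon> (\<lambda>i. x i \<omega>) j}"
    have "\<omega> \<notin> all_near S" if S: "S \<in> big" for S
    proof
      assume "\<omega> \<in> all_near S"
      then have "S \<subseteq> ?B" using S unfolding all_near_def big_def by auto
      then have "card S \<le> card ?B" by (intro card_mono) auto
      then show False using S \<omega> unfolding big_def by simp
    qed
    then show "\<omega> \<in> space P - (\<Union>S\<in>big. all_near S)" using \<omega> by auto
  next
    fix \<omega> assume \<omega>: "\<omega> \<in> space P - (\<Union>S\<in>big. all_near S)"
    let ?B = "{j\<in>{1..n}. near_earlier \<epsilon> (\<lambda>i. x i \<omega>) j}"
    have "\<omega> \<in> all_near ?B" using \<omega> unfolding all_near_def by auto
    then have "?B \<notin> big" using \<omega> by blast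
    then have "\<not> n < 4 * card ?B" unfolding big_def by blast
    then show "\<omega> \<in> ?few" using \<omega> by simp
  qed
  have U: "(\<Union>S\<in>big. all_near S) \<in> events" using fin_big events by (intro sets.finite_UN) auto
  show "?few \<in> events" unfolding few using U by auto
  have "prob (\<Union>S\<in>big. all_near S) \<le> (\<Sum>S\<in>big. prob (all_near S))"
    using fin_big events by (intro finite_measure_subadditive_finite) auto
  also have "\<dots> \<le> (\<Sum>S\<in>big. (1 / 4) ^ n)"
  proof (rule sum_mono)
    fix S assume S: "S \<in> big"
    then have "finite S" unfolding big_def by (auto intro: finite_subset)
    then have "emeasure P (all_near S) \<le> ennreal (1 / 256) ^ card S"
      unfolding all_near_def
      by (rule prob_all_near_earlier[OF _ _ ball n \<open>0 \<le> m\<close>]) (use S in \<open>auto simp: big_def\<close>)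
    then have "prob (all_near S) \<le> (1 / 256) ^ card S"
      by (simp add: emeasure_eq_measure ennreal_power)
    also have "\<dots> = ((1 / 4) ^ 4) ^ card S" by (simp add: power4_eq_xxxx)
    also have "\<dots> = (1 / 4 :: real) ^ (4 * card S)" by (rule power_mult[symmetric])
    also have "\<dots> \<le> (1 / 4) ^ n"
      using S unfolding big_def by (intro power_decreasing) auto
    finally show "prob (all_near S) \<le> (1 / 4) ^ n" .
  qed
  also have "\<dots> = real (card big) * (1 / 4) ^ n" by simp
  also have "\<dots> \<le> 2 ^ n * (1 / 4) ^ n"
  proof (rule mult_right_mono)
    have "card big \<le> card (Pow {1..n})" by (intro card_mono) (auto simp: big_def)
    also have "\<dots> = 2 ^ n" by (simp add: card_Pow)
    finally show "real (card big) \<le> 2 ^ n" by (metis of_nat_le_iff of_nat_numeral of_nat_power)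
  qed simp
  also have "\<dots> = (1 / 2) ^ n" by (simp add: power_mult_distrib[symmetric])
  finally have "prob (\<Union>S\<in>big. all_near S) \<le> (1 / 2) ^ n" .
  then show "prob ?few \<ge> 1 - (1 / 2) ^ n" unfolding few using prob_compl[OF U] by simp
qed

end

section \<open>Deterministic bounds for the power sum of a minimum spanning tree\<close>

text \<open>
  The upper bound needs no randomness. The tree edges of length at least \<open>\<epsilon>\<close> are fewer than the
  points of some \<open>\<epsilon>\<close>-separated set, hence at most a multiple of \<open>\<epsilon>\<^sup>-\<^sup>d\<close>.
\<close>

lemma E0_upper_bound:
  assumes reg: "ahlfors_regular d \<mu>" and "d > 0" "0 < \<alpha>" "\<alpha> < d"
  obtains C where "C > 0"
    "\<And>y n. (\<And>j. y j \<in> measure_support \<mu>) \<Longrightarrow> n \<ge> 1 \<Longrightarrow> E0 \<alpha> y n \<le> C * real n powr ((d - \<alpha>) / d)"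
proof -
  obtain b where b: "b > 0" and packing:
    "\<And>A \<epsilon>. finite A \<Longrightarrow> A \<subseteq> measure_support \<mu> \<Longrightarrow> 2 \<le> card A \<Longrightarrow> 0 < \<epsilon> \<Longrightarrow>
      (\<And>u v. u \<in> A \<Longrightarrow> v \<in> A \<Longrightarrow> u \<noteq> v \<Longrightarrow> \<epsilon> \<le> dist u v) \<Longrightarrow> real (card A) * (b * \<epsilon> powr d) \<le> 1"
    using ahlfors_packing[OF reg] by metis
  define C where "C = b powr (- (\<alpha> / d)) / (1 - \<alpha> / d)"
  have exponent: "0 < 1 - \<alpha> / d" "(d - \<alpha>) / d = 1 - \<alpha> / d"
    using assms(2-4) by (auto simp: field_simps)
  have C: "C > 0" using b exponent unfolding C_def by simp
  show thesis
  proof (rule that[OF C])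
    fix y :: "nat \<Rightarrow> 'a" and n :: nat
    assume y: "\<And>j. y j \<in> measure_support \<mu>" and n: "n \<ge> 1"
    define F where "F = min_spanning_tree y n"
    have mst: "is_min_spanning_tree y {1..n} F" unfolding F_def by (rule min_spanning_tree_is_min)
    then have tree: "is_spanning_tree {1..n} F" unfolding is_min_spanning_tree_def by blast
    have V: "finite {1..n}" "{1..n} \<noteq> {}" using n by auto
    have finF: "finite F" by (rule is_spanning_tree_finite[OF V(1) tree])
    have count: "real (card {e\<in>F. \<epsilon> \<le> edge_length y e}) * (b * \<epsilon> powr d) \<le> 1" if \<epsilon>: "\<epsilon> > 0" for \<epsilon>
    proof (cases "card {e\<in>F. \<epsilon> \<le> edge_length y e}")
      case (Suc k)
      obtain R where R: "R \<subseteq> {1..n}" "card R = Suc (card {e\<in>F. \<epsilon> \<le> edge_length y e})"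
        and sep: "\<And>u v. u \<in> R \<Longrightarrow> v \<in> R \<Longrightarrow> u \<noteq> v \<Longrightarrow> \<epsilon> \<le> dist (y u) (y v)"
        using long_edges_give_separated_vertices[OF V mst, of \<epsilon>] by blast
      have "inj_on y R"
        using sep \<epsilon> by (intro inj_onI) (metis dist_self not_le)
      then have card: "card (y ` R) = Suc (Suc k)" using R(2) Suc by (simp add: card_image)
      have "real (card (y ` R)) * (b * \<epsilon> powr d) \<le> 1"
      proof (rule packing[OF _ _ _ \<epsilon>])
        show "finite (y ` R)" using R(1) by (intro finite_imageI finite_subset[OF R(1)]) simp
        show "\<epsilon> \<le> dist u v" if "u \<in> y ` R" "v \<in> y ` R" "u \<noteq> v" for u v
          using that sep by blast
      qed (use y card in auto)
      moreover have "real (Suc k) * (b * \<epsilon> powr d) \<le> real (card (y ` R)) * (b * \<epsilon> powr d)"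
        unfolding card using b by (intro mult_right_mono) auto
      ultimately show ?thesis unfolding Suc by linarith
    qed simp
    have "E0 \<alpha> y n = (\<Sum>e\<in>F. edge_length y e powr \<alpha>)" unfolding E0_def F_def ..
    also have "\<dots> \<le> C * real (card F) powr (1 - \<alpha> / d)"
      unfolding C_def
      using tree edge_length_nonneg unfolding is_spanning_tree_def
      by (intro sum_powr_le_of_count_bound[OF finF assms(2-4) b count]) blast+
    also have "\<dots> \<le> C * real n powr (1 - \<alpha> / d)"
      using card_spanning_tree_le[OF V tree] n C exponent by (intro mult_left_mono powr_mono2) auto
    finally show "E0 \<alpha> y n \<le> C * real n powr ((d - \<alpha>) / d)" unfolding exponent .
  qed
qed

text \<open>
  At least half of the points are isolated at scale \<open>\<epsilon> / 2\<close>, which forces \<open>n / 4\<close> tree edges to have at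
  least this length.
\<close>

lemma E0_lower_bound:
  assumes n: "n \<ge> 2" and "\<epsilon> > 0" "\<alpha> > 0"
    and few: "4 * card {j\<in>{1..n}. \<exists>i\<in>{1..n}. i < j \<and> dist (y i) (y j) < \<epsilon>} \<le> n"
  shows "real n / 4 * (\<epsilon> / 2) powr \<alpha> \<le> E0 \<alpha> y n"
proof -
  define F where "F = min_spanning_tree y n"
  have "is_min_spanning_tree y {1..n} F" unfolding F_def by (rule min_spanning_tree_is_min)
  then have tree: "is_spanning_tree {1..n} F" unfolding is_min_spanning_tree_def by blast
  have finF: "finite F" by (rule is_spanning_tree_finite[OF _ tree]) simp
  let ?L = "{e\<in>F. \<epsilon> / 2 \<le> edge_length y e}"
  let ?N = "{i\<in>{1..n}. \<exists>j\<in>{1..n}. j \<noteq> i \<and> dist (y i) (y j) < \<epsilon> / 2}"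
  have "card ({1..n} - ?N) \<le> 2 * card ?L"
    by (rule isolated_vertices_force_long_edges[OF _ tree]) (use n in force)+
  moreover have "card ({1..n} - ?N) = n - card ?N" by (subst card_Diff_subset) auto
  moreover have "2 * card ?N \<le> n"
    using nonisolated_le_twice_near_earlier[of "{1..n}" y \<epsilon>] few by simp
  ultimately have "n \<le> 4 * card ?L" by linarith
  then have "real n / 4 * (\<epsilon> / 2) powr \<alpha> \<le> real (card ?L) * (\<epsilon> / 2) powr \<alpha>"
    by (intro mult_right_mono) auto
  also have "\<dots> \<le> (\<Sum>e\<in>?L. edge_length y e powr \<alpha>)"
    using assms(2,3) by (intro sum_bounded_below powr_mono2) auto
  also have "\<dots> \<le> (\<Sum>e\<in>F. edge_length y e powr \<alpha>)"
    using finF by (intro sum_mono2) auto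
  finally show ?thesis unfolding E0_def F_def .
qed

section \<open>Measurability of the power sum\<close>

context ahlfors_sample
begin

text \<open>
  On the event that all points lie in the support, the distances are measurable. The chosen minimum
  spanning tree depends on the sample only through the set of all minimum spanning trees, which takes
  finitely many values, each on a measurable event.
\<close>

lemma E0_event:
  "{\<omega> \<in> sampled_in_support. a \<le> E0 \<alpha> (\<lambda>j. x j \<omega>) n \<and> E0 \<alpha> (\<lambda>j. x j \<omega>) n \<le> b} \<in> events"
proof -
  let ?V = "{1..n}"
  let ?w = "\<lambda>e \<omega>. edge_length (\<lambda>j. x j \<omega>) e"
  define M where "M = restrict_space P sampled_in_support"
  define Trees where "Trees = {F. is_spanning_tree ?V F}"
  have sub: "sampled_in_support \<subseteq> space P" unfolding sampled_in_support_def by auto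
  have space_M: "space M = sampled_in_support"
    unfolding M_def using sub by (auto simp: space_restrict_space)
  have dist: "(\<lambda>\<omega>. dist (x i \<omega>) (x j \<omega>)) \<in> borel_measurable M" for i j
  proof (subst borel_measurable_iff_less, intro allI)
    fix r
    have "x k \<in> borel_measurable M" for k
      unfolding M_def by (rule measurable_restrict_space1) measurable
    then have "{\<omega> \<in> space M. x i \<omega> \<in> X \<and> dist (x i \<omega>) (x j \<omega>) < r} \<in> sets M"
      using near_pred[of "x i" M "x j" r] by (simp add: pred_def)
    also have "{\<omega> \<in> space M. x i \<omega> \<in> X \<and> dist (x i \<omega>) (x j \<omega>) < r}
        = {\<omega> \<in> space M. dist (x i \<omega>) (x j \<omega>) < r}"
      unfolding space_M sampled_in_support_def by auto
    finally show "{\<omega> \<in> space M. dist (x i \<omega>) (x j \<omega>) < r} \<in> sets M" .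
  qed
  have finT: "finite Trees" unfolding Trees_def by (rule finite_spanning_trees) simp
  have edge: "?w e \<in> borel_measurable M" if F: "F \<in> Trees" "e \<in> F" for e F
  proof -
    obtain u v where "e = {u, v}"
      using F unfolding Trees_def is_spanning_tree_def complete_graph_edges_def by blast
    then show ?thesis using dist by (simp add: edge_length_pair)
  qed
  have sums [measurable]: "(\<lambda>\<omega>. \<Sum>e\<in>F. ?w e \<omega>) \<in> borel_measurable M"
      "(\<lambda>\<omega>. \<Sum>e\<in>F. ?w e \<omega> powr \<alpha>) \<in> borel_measurable M" if "F \<in> Trees" for F
    using edge[OF that] by (auto intro!: borel_measurable_sum)
  define minimal where "minimal F \<omega> \<longleftrightarrow> (\<forall>F'\<in>Trees. (\<Sum>e\<in>F. ?w e \<omega>) \<le> (\<Sum>e\<in>F'. ?w e \<omega>))" for F \<omega>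
  have minimal: "Measurable.pred M (minimal F)" if "F \<in> Trees" for F
    unfolding minimal_def using finT
    by (intro pred_intros_finite) (auto simp: pred_def intro!: borel_measurable_le sums that)
  have mst: "is_min_spanning_tree (\<lambda>j. x j \<omega>) ?V F \<longleftrightarrow> F \<in> Trees \<and> minimal F \<omega>" for F \<omega>
    unfolding is_min_spanning_tree_def minimal_def Trees_def by auto
  define pick where "pick S = (SOME F. F \<in> S)" for S :: "nat set set set"
  \<comment> \<open>For a family that is not realised as the set of minimal trees, the choice can be arbitrary;
    restricting to families with \<open>pick S \<in> Trees\<close> keeps its edge lengths measurable.\<close>
  define families where "families = {S \<in> Pow Trees. pick S \<in> Trees}"
  have "a \<le> E0 \<alpha> (\<lambda>j. x j \<omega>) n \<and> E0 \<alpha> (\<lambda>j. x j \<omega>) n \<le> b \<longleftrightarrow>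
      (\<exists>S\<in>families. (\<forall>F\<in>Trees. F \<in> S \<longleftrightarrow> minimal F \<omega>) \<and>
        a \<le> (\<Sum>e\<in>pick S. ?w e \<omega> powr \<alpha>) \<and> (\<Sum>e\<in>pick S. ?w e \<omega> powr \<alpha>) \<le> b)" (is "?L \<longleftrightarrow> ?R") for \<omega>
  proof -
    define T where "T = {F \<in> Trees. minimal F \<omega>}"
    have pick_T: "pick T = min_spanning_tree (\<lambda>j. x j \<omega>) n"
      unfolding pick_def T_def min_spanning_tree_def mst by simp
    have "pick T \<in> Trees"
      using min_spanning_tree_is_min[of "\<lambda>j. x j \<omega>" n] unfolding mst pick_T by simp
    then have T: "T \<in> families" unfolding families_def by (simp add: T_def)
    have unique: "S = T" if "S \<in> families" "\<forall>F\<in>Trees. F \<in> S \<longleftrightarrow> minimal F \<omega>" for S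
      using that unfolding families_def T_def by blast
    have "\<forall>F\<in>Trees. F \<in> T \<longleftrightarrow> minimal F \<omega>" unfolding T_def by blast
    then have "?R \<longleftrightarrow> a \<le> (\<Sum>e\<in>pick T. ?w e \<omega> powr \<alpha>) \<and> (\<Sum>e\<in>pick T. ?w e \<omega> powr \<alpha>) \<le> b"
      using T unique by metis
    then show ?thesis unfolding pick_T E0_def by simp
  qed
  moreover have "Measurable.pred M (\<lambda>\<omega>. \<exists>S\<in>families. (\<forall>F\<in>Trees. F \<in> S \<longleftrightarrow> minimal F \<omega>) \<and>
        a \<le> (\<Sum>e\<in>pick S. ?w e \<omega> powr \<alpha>) \<and> (\<Sum>e\<in>pick S. ?w e \<omega> powr \<alpha>) \<le> b)"
  proof (intro pred_intros_finite pred_intros_logic)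
    show "finite families" unfolding families_def using finT by simp
    fix S assume "S \<in> families"
    then have "pick S \<in> Trees" unfolding families_def by simp
    then show "Measurable.pred M (\<lambda>\<omega>. a \<le> (\<Sum>e\<in>pick S. ?w e \<omega> powr \<alpha>))"
      "Measurable.pred M (\<lambda>\<omega>. (\<Sum>e\<in>pick S. ?w e \<omega> powr \<alpha>) \<le> b)"
      by measurable
  qed (use finT minimal in auto)
  ultimately have "{\<omega> \<in> space M. a \<le> E0 \<alpha> (\<lambda>j. x j \<omega>) n \<and> E0 \<alpha> (\<lambda>j. x j \<omega>) n \<le> b} \<in> sets M"
    by (simp add: pred_def)
  then show ?thesis
    unfolding space_M using sampled_in_support_events sub
    by (auto simp: M_def sets_restrict_space_iff)
qed

lemma E0_event_completion:
  "{\<omega> \<in> space P. a \<le> E0 \<alpha> (\<lambda>j. x j \<omega>) n \<and> E0 \<alpha> (\<lambda>j. x j \<omega>) n \<le> b} \<in> sets (completion P)"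
    (is "?E \<in> _")
proof (rule sets_completionI)
  show "?E = (?E \<inter> sampled_in_support) \<union> (?E - sampled_in_support)" by blast
  have "?E \<inter> sampled_in_support =
      {\<omega> \<in> sampled_in_support. a \<le> E0 \<alpha> (\<lambda>j. x j \<omega>) n \<and> E0 \<alpha> (\<lambda>j. x j \<omega>) n \<le> b}"
    unfolding sampled_in_support_def by auto
  then show "?E \<inter> sampled_in_support \<in> events" using E0_event[of a \<alpha> n b] by simp
  show "?E - sampled_in_support \<subseteq> space P - sampled_in_support" by blast
  have "space P - sampled_in_support \<in> events" using sampled_in_support_events by blast
  then show "space P - sampled_in_support \<in> null_sets P"
    using AE_sampled_in_support by (simp add: AE_iff_null_sets)
qed

section \<open>The growth rate of the power sum\<close>

lemma E0_asymptotics: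
  assumes \<alpha>: "0 < \<alpha>" "\<alpha> < d"
  shows "\<exists>C1 C2. 0 < C1 \<and> C1 \<le> C2 \<and>
    (\<lambda>n. \<P>(\<omega> in completion P.
        C1 * real n powr ((d - \<alpha>) / d) \<le> E0 \<alpha> (\<lambda>j. x j \<omega>) n \<and>
        E0 \<alpha> (\<lambda>j. x j \<omega>) n \<le> C2 * real n powr ((d - \<alpha>) / d))) \<longlonglongrightarrow> 1"
proof -
  obtain c \<delta>0 where c: "c > 0" "\<delta>0 > 0" and upper: "\<And>u \<delta>. u \<in> X \<Longrightarrow> 0 < \<delta> \<Longrightarrow>
      \<delta> < \<delta>0 \<Longrightarrow> measure \<mu> (ball u \<delta>) \<le> c * \<delta> powr d"
    using regular unfolding ahlfors_regular_def by blast
  obtain C where C: "C > 0" "\<And>y n. (\<And>j. y j \<in> X) \<Longrightarrow> n \<ge> 1 \<Longrightarrow>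
      E0 \<alpha> y n \<le> C * real n powr ((d - \<alpha>) / d)"
    using E0_upper_bound[OF regular dim_pos \<alpha>] by metis
  \<comment> \<open>At scale \<open>\<epsilon> n\<close> the union of \<open>n\<close> balls has mass at most \<open>n c (\<epsilon> n)\<^sup>d = 1 / 256\<close>.\<close>
  define \<theta> where "\<theta> = (1 / (256 * c)) powr (1 / d)"
  define \<epsilon> where "\<epsilon> n = \<theta> * real n powr (- (1 / d))" for n
  define C1 where "C1 = 1 / 4 * (\<theta> / 2) powr \<alpha>"
  define C2 where "C2 = max C1 C"
  define E where "E n = {\<omega> \<in> space P. C1 * real n powr ((d - \<alpha>) / d) \<le> E0 \<alpha> (\<lambda>j. x j \<omega>) n \<and>
    E0 \<alpha> (\<lambda>j. x j \<omega>) n \<le> C2 * real n powr ((d - \<alpha>) / d)}" for n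
  define few where "few n = {\<omega> \<in> space P. 4 * card {j\<in>{1..n}. near_earlier (\<epsilon> n) (\<lambda>i. x i \<omega>) j} \<le> n}" for n
  have \<theta>: "\<theta> > 0" unfolding \<theta>_def using c by simp
  have C1: "C1 > 0" unfolding C1_def using \<theta> by simp
  interpret completion: prob_space "completion P" by (rule prob_space_completion)
  have \<epsilon>_lim: "\<epsilon> \<longlonglongrightarrow> 0"
  proof -
    have "(\<lambda>n. real n powr (- (1 / d))) \<longlonglongrightarrow> 0"
      using dim_pos by (intro tendsto_neg_powr filterlim_real_sequentially) simp
    then show ?thesis unfolding \<epsilon>_def by (rule tendsto_mult_right_zero)
  qed
  have lower: "1 - (1 / 2) ^ n \<le> measure (completion P) (E n)" if n: "n \<ge> 2" "\<epsilon> n < \<delta>0" for n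
  proof -
    have \<epsilon>: "\<epsilon> n > 0" unfolding \<epsilon>_def using \<theta> n by simp
    have mass: "real n * (c * \<epsilon> n powr d) \<le> 1 / 256"
    proof -
      have "\<theta> powr d = 1 / (256 * c)"
        unfolding \<theta>_def using c dim_pos by (simp add: powr_powr)
      moreover have "(real n powr (- (1 / d))) powr d = real n powr (- (1 / d) * d)"
        by (rule powr_powr)
      moreover have "real n powr (- (1 / d) * d) = 1 / real n"
        using dim_pos n by (simp add: powr_minus_divide)
      ultimately have "\<epsilon> n powr d = 1 / (256 * c) * (1 / real n)"
        unfolding \<epsilon>_def by (subst powr_mult) simp
      then show ?thesis using c n by simp
    qed
    have ball: "measure \<mu> (ball u (\<epsilon> n)) \<le> c * \<epsilon> n powr d" if "u \<in> X" for u
      using upper[OF that \<epsilon> n(2)] .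
    have "0 \<le> c * \<epsilon> n powr d" using c by simp
    note few = prob_few_near_earlier[OF ball mass this, folded few_def]
    have "few n \<inter> sampled_in_support \<subseteq> E n"
    proof
      fix \<omega> assume \<omega>: "\<omega> \<in> few n \<inter> sampled_in_support"
      then have inX: "x j \<omega> \<in> X" for j unfolding sampled_in_support_def by blast
      have "near_earlier (\<epsilon> n) (\<lambda>i. x i \<omega>) j \<longleftrightarrow>
          (\<exists>i\<in>{1..n}. i < j \<and> dist (x i \<omega>) (x j \<omega>) < \<epsilon> n)" if "j \<in> {1..n}" for j
      proof -
        have "{1..<j} = {i \<in> {1..n}. i < j}" using that by auto
        then show ?thesis unfolding near_earlier_def using inX by auto
      qed
      then have "{j\<in>{1..n}. near_earlier (\<epsilon> n) (\<lambda>i. x i \<omega>) j} =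
          {j\<in>{1..n}. \<exists>i\<in>{1..n}. i < j \<and> dist (x i \<omega>) (x j \<omega>) < \<epsilon> n}"
        by (intro Collect_cong conj_cong refl)
      then have "real n / 4 * (\<epsilon> n / 2) powr \<alpha> \<le> E0 \<alpha> (\<lambda>j. x j \<omega>) n"
        using \<omega> unfolding few_def by (intro E0_lower_bound[OF n(1) \<epsilon> \<alpha>(1)]) auto
      also have "real n / 4 * (\<epsilon> n / 2) powr \<alpha> = C1 * real n powr ((d - \<alpha>) / d)"
      proof -
        have "(\<epsilon> n / 2) powr \<alpha> = (\<theta> / 2) powr \<alpha> * real n powr (- (\<alpha> / d))"
          unfolding \<epsilon>_def using \<theta> by (simp add: powr_mult powr_powr powr_divide)
        moreover have "real n powr ((d - \<alpha>) / d) = real n * real n powr (- (\<alpha> / d))"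
          using n(1) dim_pos by (simp add: diff_divide_distrib powr_diff powr_minus_divide)
        ultimately show ?thesis unfolding C1_def by simp
      qed
      finally have "C1 * real n powr ((d - \<alpha>) / d) \<le> E0 \<alpha> (\<lambda>j. x j \<omega>) n" .
      moreover have "E0 \<alpha> (\<lambda>j. x j \<omega>) n \<le> C * real n powr ((d - \<alpha>) / d)"
        using C(2)[of "\<lambda>j. x j \<omega>" n] inX n by simp
      moreover have "\<dots> \<le> C2 * real n powr ((d - \<alpha>) / d)"
        unfolding C2_def by (intro mult_right_mono) auto
      ultimately show "\<omega> \<in> E n" using \<omega> unfolding E_def few_def by auto
    qed
    then have "measure (completion P) (few n \<inter> sampled_in_support) \<le> measure (completion P) (E n)"
      unfolding E_def by (intro completion.finite_measure_mono E0_event_completion)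
    moreover have "measure (completion P) (few n \<inter> sampled_in_support) = prob (few n)"
    proof -
      have "prob (few n \<inter> sampled_in_support) = prob (few n)"
        using AE_sampled_in_support few(1) sampled_in_support_events
        by (intro finite_measure_eq_AE) auto
      then show ?thesis using few(1) sampled_in_support_events by simp
    qed
    ultimately show ?thesis using few(2) by simp
  qed
  have "eventually (\<lambda>n. \<epsilon> n < \<delta>0) sequentially"
    using \<epsilon>_lim c(2) by (rule order_tendstoD)
  then have "eventually (\<lambda>n. 1 - (1 / 2) ^ n \<le> measure (completion P) (E n)) sequentially"
    using eventually_ge_at_top[of 2] by eventually_elim (rule lower)
  moreover have "eventually (\<lambda>n. measure (completion P) (E n) \<le> 1) sequentially"
    by (simp add: completion.prob_le_1)
  moreover have "(\<lambda>n. 1 - (1 / 2 :: real) ^ n) \<longlonglongrightarrow> 1"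
    using tendsto_diff[OF tendsto_const[of "1 :: real"] LIMSEQ_realpow_zero[of "1 / 2 :: real"]] by simp
  ultimately have lim: "(\<lambda>n. measure (completion P) (E n)) \<longlonglongrightarrow> 1"
    by (rule tendsto_sandwich[OF _ _ _ tendsto_const])
  have "C1 \<le> C2" unfolding C2_def by simp
  with C1 lim show ?thesis
    unfolding E_def space_completion by (intro exI[of _ C1] exI[of _ C2] conjI)
qed

end

theorem theorem3:
  fixes \<mu> :: "'a::metric_space measure"
    and P :: "'b measure"
    and x :: "nat \<Rightarrow> 'b \<Rightarrow> 'a"
    and d \<alpha> :: real
  assumes "d > 0"
    and "ahlfors_regular d \<mu>"
    and "prob_space P"
    and "prob_space.indep_vars P (\<lambda>_. borel) x UNIV"
    and "\<And>j. distr P borel (x j) = \<mu>"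
    and "0 < \<alpha>" and "\<alpha> < d"
  shows "\<exists>C1 C2. 0 < C1 \<and> C1 \<le> C2 \<and>
    (\<lambda>n. \<P>(\<omega> in completion P.
        C1 * real n powr ((d - \<alpha>) / d) \<le> E0 \<alpha> (\<lambda>j. x j \<omega>) n \<and>
        E0 \<alpha> (\<lambda>j. x j \<omega>) n \<le> C2 * real n powr ((d - \<alpha>) / d))) \<longlonglongrightarrow> 1"
proof -
  interpret prob_space P by fact
  interpret ahlfors_sample P \<mu> x d
    by unfold_locales (fact assms)+
  show ?thesis using assms(6,7) by (rule E0_asymptotics)
qed

end
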